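(* $\mathcal{I}_{\Delta}\subset\mathcal{I}_{\mathrm{CF}}$; that is, the ideal of $(\mathcal{A}^0,ш)$ generated by the duality relations is contained in the module of confluence relations.
   Context: Let $\mathcal{A}_z=\mathbb{Z}\langle e_0,e_1,e_z\rangle$ be the free non-commutative (associative, unital) ring on formal symbols $e_0,e_1,e_z$, and $\mathcal{A}=\mathbb{Z}\langle e_0,e_1\rangle\subset\mathcal{A}_z$. Put $\mathcal{A}_z^0=\mathbb{Z}\oplus\mathbb{Z}e_z\oplus\bigoplus_{a\in\{1,z\},\,b\in\{0,z\}}e_a\mathcal{A}_ze_b$, $\mathcal{A}^0=\mathbb{Z}\oplus e_1\mathcal{A}e_0$, $\mathcal{A}_z^{-2}=\mathbb{Z}\oplus e_1\mathcal{A}_ze_0\oplus e_z\mathcal{A}_ze_0$, and $\mathcal{A}_z^{-1}=\mathcal{A}_z^{-2}\,\mathbb{Z}\langle e_z\rangle$ (the span of concatenations $ue_z^k$, $u\in\mathcal{A}_z^{-2}$, $k\ge0$). Tensor products are over $\mathbb{Z}$. The shuffle product $ш$ on $\mathcal{A}_z$ is the bilinear product with $w\,ш\,1=1\,ш\,w=w$ and $e_au\,ш\,e_bv=e_a(u\,ш\,e_bv)+e_b(e_au\,ш\,v)$; $\mathcal{A}^0$ and $\mathcal{A}_z^0$ are commutative rings under $ш$. Let $\tau_\infty$ be the anti-automorphism of the ring $\mathcal{A}$ with $\tau_\infty(e_0)=-e_1$, $\tau_\infty(e_1)=-e_0$, and set $\Delta(w)=w-\tau_\infty(w)$. $\mathcal{I}_\Delta$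 is the ideal of $(\mathcal{A}^0,ш)$ generated by $\{\Delta(w)\mid w\in\mathcal{A}^0\}$. For $\alpha,\beta\in\{0,1,z\}$ define the linear operator $\partial_{\alpha,\beta}$ on $\mathcal{A}_z$ by $\partial_{\alpha,\beta}(e_{a_1}\cdots e_{a_n})=\sum_{i=1}^n\left(\delta_{\{a_i,a_{i+1}\},\{\alpha,\beta\}}-\delta_{\{a_{i-1},a_i\},\{\alpha,\beta\}}\right)e_{a_1}\cdots\widehat{e_{a_i}}\cdots e_{a_n}$, where $a_0=0$, $a_{n+1}=1$, the hat denotes omission, and $\delta_{S,T}=1$ if $S=T$ as sets and $0$ otherwise. $\mathrm{Const}:\mathcal{A}_z\to\mathcal{A}$ is the linear map sending a word to itself if it contains no letter $e_z$, and to $0$ otherwise. The set of standard relations is $\mathcal{I}_{\mathrm{ST}}=\{w\in\mathcal{A}_z^0\mid \mathrm{Const}(\partial_{z,\alpha_1}\cdots\partial_{z,\alpha_r}w)=0\text{ for all }r\ge0\text{ and }\alpha_1,\dots,\alpha_r\in\{0,1\}\}$. The duality map $\tau_z$ is the anti-automorphism of the ring $\mathcal{A}_z$ with $\tau_z(e_0)=e_z-e_1$, $\tau_z(e_1)=e_z-e_0$, $\tau_z(e_z)=e_z$. The map $u\otimes v\mapsto u\,ш\,v$ is an isomorphism $\mathcal{A}_z^{-2}\otimes(\mathcal{A}_z^0\cap\mathbb{Z}\langle e_1,e_z\rangle)\to\mathcal{A}_z^0$; let $\mathrm{reg}_{\{z,1\}}$ be its inverse. It is also an isomorphism $\mathcal{A}_z^{-2}\otimes\mathbb{Z}\langle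 e_z\rangle\to\mathcal{A}_z^{-1}$; let $\mathrm{reg}_{\{z\}}$ be its inverse. Define $N:\mathcal{A}_z^0\to\mathcal{A}_z^{-1}$ as the composition of $\mathrm{reg}_{\{z,1\}}$, then $\mathrm{id}\otimes\tau_z$ (which lands in $\mathcal{A}_z^{-2}\otimes(\mathcal{A}_z^0\cap\mathbb{Z}\langle e_0,e_z\rangle)$), then $u\otimes v\mapsto u\,ш\,v$. Define $\lambda:\mathcal{A}_z^0\to\mathcal{A}^0$ as the composition of $N$, then $\mathrm{reg}_{\{z\}}$, then $\mathrm{id}\otimes\mathrm{const}:\mathcal{A}_z^{-2}\otimes\mathbb{Z}\langle e_z\rangle\to\mathcal{A}_z^{-2}$ (where $\mathrm{const}$ takes the constant term: $1\mapsto1$, $e_z^k\mapsto0$ for $k\ge1$), then $\lambda':\mathcal{A}_z^{-2}\to\mathcal{A}^0$, the restriction of the ring homomorphism replacing $e_z$ by $e_1$. The module of confluence relations is $\mathcal{I}_{\mathrm{CF}}=\{\lambda(w)\mid w\in\mathcal{I}_{\mathrm{ST}}\}\subset\mathcal{A}^0$. *)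

theory Defs
  imports "HOL-Library.Poly_Mapping" "HOL-Algebra.Ideal"
begin

section \<open>The free ring on three letters\<close>

datatype letter = L0 | L1 | Lz

text \<open>
  Words form the free monoid under concatenation. Written additively, as the convolution
  product of \<^theory>\<open>HOL-Library.Poly_Mapping\<close> requires, this makes
  \<open>letter list \<Rightarrow>\<^sub>0 int\<close> the monoid ring of that monoid, i.e. the free associative unital
  ring $\mathbb{Z}\langle e_0, e_1, e_z\rangle$ with \<open>*\<close> as concatenation product.
\<close>

instantiation list :: (type) monoid_add
begin

definition zero_list :: "'a list" where "zero_list = []"

definition plus_list :: "'a list \<Rightarrow> 'a list \<Rightarrow> 'a list" where "plus_list = append"

instance by standard (simp_all add: zero_list_def plus_list_def)

end

type_synonym ncpoly = "letter list \<Rightarrow>\<^sub>0 int"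

definition ltr :: "letter \<Rightarrow> ncpoly" where
  "ltr a = frag_of [a]"

lemma frag_of_Nil: "frag_of ([] :: letter list) = 1"
  by (simp add: zero_list_def[symmetric])

lemma frag_of_append: "frag_of (u @ v :: letter list) = frag_of u * frag_of v"
  by (simp add: plus_list_def[symmetric] mult_single)

definition word_span :: "'a set \<Rightarrow> ('a \<Rightarrow>\<^sub>0 int) set" where
  "word_span W = {p. Poly_Mapping.keys p \<subseteq> W}"

definition words_z0 :: "letter list set" where
  "words_z0 = {[]} \<union> {[Lz]} \<union> {[a] @ w @ [b] | a w b. a \<in> {L1, Lz} \<and> b \<in> {L0, Lz}}"

definition words_zm2 :: "letter list set" where
  "words_zm2 = {[]} \<union> {[L1] @ w @ [L0] | w. True} \<union> {[Lz] @ w @ [L0] | w. True}"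

definition words_zm1 :: "letter list set" where
  "words_zm1 = {u @ replicate k Lz | u k. u \<in> words_zm2}"

definition words_0 :: "letter list set" where
  "words_0 = {[]} \<union> {[L1] @ w @ [L0] | w. w \<in> lists {L0, L1}}"

definition Az0 :: "ncpoly set" where "Az0 = word_span words_z0"
definition Azm2 :: "ncpoly set" where "Azm2 = word_span words_zm2"
definition Azm1 :: "ncpoly set" where "Azm1 = word_span words_zm1"
definition A0 :: "ncpoly set" where "A0 = word_span words_0"

text \<open>The ring homomorphism, respectively anti-homomorphism, with prescribed values on letters.\<close>

definition hom_ext :: "(letter \<Rightarrow> ncpoly) \<Rightarrow> ncpoly \<Rightarrow> ncpoly" where
  "hom_ext f = frag_extend (\<lambda>w. prod_list (map f w))"

definition antihom_ext :: "(letter \<Rightarrow> ncpoly) \<Rightarrow> ncpoly \<Rightarrow> ncpoly" where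
  "antihom_ext f = frag_extend (\<lambda>w. prod_list (rev (map f w)))"


section \<open>Shuffle product and duality relations\<close>

fun shuffle_words :: "letter list \<Rightarrow> letter list \<Rightarrow> ncpoly" where
  "shuffle_words [] v = frag_of v"
| "shuffle_words (a # u) [] = frag_of (a # u)"
| "shuffle_words (a # u) (b # v) =
     ltr a * shuffle_words u (b # v) + ltr b * shuffle_words (a # u) v"

definition shuffle :: "ncpoly \<Rightarrow> ncpoly \<Rightarrow> ncpoly" where
  "shuffle p q = frag_extend (\<lambda>u. frag_extend (\<lambda>v. shuffle_words u v) q) p"

definition A0_ring :: "ncpoly ring" where
  "A0_ring = \<lparr>carrier = A0, monoid.mult = shuffle, one = 1, zero = 0, add = (+)\<rparr>"

text \<open>\<open>tau_inf\<close> is only used on $\mathbb{Z}\langle e_0, e_1\rangle$; its value on \<open>Lz\<close> is immaterial.\<close>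

definition tau_inf :: "ncpoly \<Rightarrow> ncpoly" where
  "tau_inf = antihom_ext (\<lambda>a. case a of L0 \<Rightarrow> - ltr L1 | L1 \<Rightarrow> - ltr L0 | Lz \<Rightarrow> ltr Lz)"

definition Delta :: "ncpoly \<Rightarrow> ncpoly" where
  "Delta w = w - tau_inf w"

definition I_Delta :: "ncpoly set" where
  "I_Delta = genideal A0_ring (Delta ` A0)"


section \<open>Standard relations\<close>

definition pdiff_word :: "letter \<Rightarrow> letter \<Rightarrow> letter list \<Rightarrow> ncpoly" where
  "pdiff_word \<alpha> \<beta> w =
     (let a = [L0] @ w @ [L1] in
      \<Sum>i = 1..length w.
        frag_cmul (of_bool ({a ! i, a ! (i + 1)} = {\<alpha>, \<beta>}) - of_bool ({a ! (i - 1), a ! i} = {\<alpha>, \<beta>}))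
          (frag_of (take (i - 1) w @ drop i w)))"

definition pdiff :: "letter \<Rightarrow> letter \<Rightarrow> ncpoly \<Rightarrow> ncpoly" where
  "pdiff \<alpha> \<beta> = frag_extend (pdiff_word \<alpha> \<beta>)"

definition Const :: "ncpoly \<Rightarrow> ncpoly" where
  "Const = frag_extend (\<lambda>w. if Lz \<in> set w then 0 else frag_of w)"

definition I_ST :: "ncpoly set" where
  "I_ST = {w \<in> Az0. \<forall>\<alpha>s \<in> lists {L0, L1}. Const (foldr (pdiff Lz) \<alpha>s w) = 0}"


section \<open>Confluence relations\<close>

text \<open>
  The tensor product over the integers of the modules spanned by sets of words \<open>U\<close> and \<open>V\<close>
  is free on \<open>U \<times> V\<close>, and is rendered as \<open>word_span (U \<times> V)\<close>.
\<close>

type_synonym ncpoly2 = "(letter list \<times> letter list) \<Rightarrow>\<^sub>0 int"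

definition tensor :: "ncpoly \<Rightarrow> ncpoly \<Rightarrow> ncpoly2" where
  "tensor p q = frag_extend (\<lambda>u. frag_extend (\<lambda>v. frag_of (u, v)) q) p"

definition id_tensor :: "(ncpoly \<Rightarrow> ncpoly) \<Rightarrow> ncpoly2 \<Rightarrow> ncpoly2" where
  "id_tensor f = frag_extend (\<lambda>(u, v). tensor (frag_of u) (f (frag_of v)))"

definition shuffle_tensor :: "ncpoly2 \<Rightarrow> ncpoly" where
  "shuffle_tensor = frag_extend (\<lambda>(u, v). shuffle (frag_of u) (frag_of v))"

definition tau_z :: "ncpoly \<Rightarrow> ncpoly" where
  "tau_z = antihom_ext (\<lambda>a. case a of L0 \<Rightarrow> ltr Lz - ltr L1 | L1 \<Rightarrow> ltr Lz - ltr L0 | Lz \<Rightarrow> ltr Lz)"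

text \<open>
  \<open>shuffle_tensor\<close> is bijective from \<open>word_span (words_zm2 \<times> (words_z0 \<inter> lists {L1, Lz}))\<close>
  onto \<open>Az0\<close>, and from \<open>word_span (words_zm2 \<times> lists {Lz})\<close> onto \<open>Azm1\<close>; on these
  codomains the following are its inverses.
\<close>

definition reg_z1 :: "ncpoly \<Rightarrow> ncpoly2" where
  "reg_z1 = inv_into (word_span (words_zm2 \<times> (words_z0 \<inter> lists {L1, Lz}))) shuffle_tensor"

definition reg_z :: "ncpoly \<Rightarrow> ncpoly2" where
  "reg_z = inv_into (word_span (words_zm2 \<times> lists {Lz})) shuffle_tensor"

definition N_map :: "ncpoly \<Rightarrow> ncpoly" where
  "N_map w = shuffle_tensor (id_tensor tau_z (reg_z1 w))"

definition const_term :: "ncpoly \<Rightarrow> int" where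
  "const_term p = Poly_Mapping.lookup p []"

definition id_const :: "ncpoly2 \<Rightarrow> ncpoly" where
  "id_const = frag_extend (\<lambda>(u, v). frag_cmul (const_term (frag_of v)) (frag_of u))"

definition lambda' :: "ncpoly \<Rightarrow> ncpoly" where
  "lambda' = hom_ext (\<lambda>a. case a of L0 \<Rightarrow> ltr L0 | L1 \<Rightarrow> ltr L1 | Lz \<Rightarrow> ltr L1)"

definition lambda_map :: "ncpoly \<Rightarrow> ncpoly" where
  "lambda_map w = lambda' (id_const (reg_z (N_map w)))"

definition I_CF :: "ncpoly set" where
  "I_CF = lambda_map ` I_ST"

end

theory Submission
  imports Defs
begin

text \<open>
  For \<open>w\<close> in \<open>A0\<close> the element \<open>x = tau_z w - tau_inf w\<close> is a standard relation: its constant part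
  vanishes, and so do all its derivatives, because \<open>tau_z w\<close> is a product of factors
  \<open>e\<^sub>z - e\<^sub>\<beta>\<close> on which the interior and boundary contributions to each derivation cancel.
  Its image under \<open>lambda\<close> is \<open>w - tau_inf w\<close>. Indeed \<open>lambda\<close> is the identity on \<open>A0\<close>. In
  \<open>tau_z w\<close> the words containing \<open>e\<^sub>0\<close> combine to terms \<open>tau_z(w') e\<^sub>0 y\<close> with \<open>w'\<close> ending in
  \<open>e\<^sub>0\<close>; they regularize to shuffles with a factor killed by \<open>e\<^sub>z \<mapsto> e\<^sub>1\<close>, since
  \<open>tau_z e\<^sub>0 = e\<^sub>z - e\<^sub>1\<close>. The words without \<open>e\<^sub>0\<close> are mapped by \<open>tau_z\<close> to \<open>w\<close> with \<open>e\<^sub>1\<close> replaced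
  by \<open>e\<^sub>z\<close>, hence by \<open>lambda\<close> to \<open>w\<close>. Finally the derivations of the shuffle algebra
  vanish on \<open>A0\<close> and \<open>lambda\<close> is compatible with shuffles, so the images of standard relations
  are stable under shuffling with \<open>A0\<close>.
\<close>

section \<open>Additive maps on free modules\<close>

lemma frag_of_Cons: "frag_of (a # w) = ltr a * frag_of w"
  using frag_of_append[of "[a]" w] by (simp add: ltr_def)

text \<open>Differences generate sums and integer multiples, so an additive statement needs checking
  on words only.\<close>

lemma frag_induct [case_names zero word diff]:
  assumes "P 0" "\<And>w. P (frag_of w)" "\<And>p q. P p \<Longrightarrow> P q \<Longrightarrow> P (p - q)"
  shows "P p"
  using frag_induction[of p UNIV P] assms by auto

lemma word_span_induct [consumes 1, case_names zero word diff]: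
  assumes "p \<in> word_span W" "P 0" "\<And>w. w \<in> W \<Longrightarrow> P (frag_of w)"
    "\<And>p q. P p \<Longrightarrow> P q \<Longrightarrow> P (p - q)"
  shows "P p"
  using frag_induction[of p W P] assms by (auto simp: word_span_def)

lemma minus_closed_imp_plus_closed:
  fixes S :: "'a::ab_group_add set"
  assumes "\<And>x y. x \<in> S \<Longrightarrow> y \<in> S \<Longrightarrow> x - y \<in> S" "0 \<in> S" "x \<in> S" "y \<in> S"
  shows "x + y \<in> S"
  using assms(1)[OF assms(3) assms(1)[OF assms(2,4)]] by simp

lemma word_span_0 [simp]: "0 \<in> word_span W"
  by (simp add: word_span_def)

lemma word_span_frag_of [simp]: "frag_of w \<in> word_span W \<longleftrightarrow> w \<in> W"
  by (simp add: word_span_def)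

lemma word_span_diff: "p \<in> word_span W \<Longrightarrow> q \<in> word_span W \<Longrightarrow> p - q \<in> word_span W"
  using keys_diff[of p q] by (auto simp: word_span_def)

lemma word_span_add: "p \<in> word_span W \<Longrightarrow> q \<in> word_span W \<Longrightarrow> p + q \<in> word_span W"
  using keys_add[of p q] by (auto simp: word_span_def)

lemma word_span_uminus: "p \<in> word_span W \<Longrightarrow> - p \<in> word_span W"
  by (simp add: word_span_def)

lemma word_span_mono: "V \<subseteq> W \<Longrightarrow> word_span V \<subseteq> word_span W"
  by (auto simp: word_span_def)

lemma word_span_ltr_mult:
  assumes "p \<in> word_span V" "\<And>w. w \<in> V \<Longrightarrow> a # w \<in> W"
  shows "ltr a * p \<in> word_span W"
  using assms(1)
  by (induction p rule: word_span_induct)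
    (simp_all add: frag_of_Cons[symmetric] assms(2) right_diff_distrib word_span_diff)

lemma word_span_mult_frag:
  fixes p :: ncpoly
  assumes "p \<in> word_span V" "\<And>w. w \<in> V \<Longrightarrow> w @ v \<in> W"
  shows "p * frag_of v \<in> word_span W"
  using assms(1)
  by (induction p rule: word_span_induct)
    (simp_all add: frag_of_append[symmetric] assms(2) left_diff_distrib word_span_diff
      del: mult_single)

section \<open>The shuffle product\<close>

lemma shuffle_frag_of: "shuffle (frag_of u) (frag_of v) = shuffle_words u v"
  by (simp add: shuffle_def)

lemma shuffle_diff_left: "shuffle (p - q) r = shuffle p r - shuffle q r"
  by (simp add: shuffle_def frag_extend_diff)

lemma frag_extend_fun_diff:
  "frag_extend (\<lambda>u. f u - g u) p = frag_extend f p - frag_extend g p"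
  by (induction p rule: frag_induct) (simp_all add: frag_extend_diff)

lemma shuffle_diff_right: "shuffle r (p - q) = shuffle r p - shuffle r q"
  by (simp add: shuffle_def frag_extend_diff frag_extend_fun_diff)

lemma shuffle_0_left [simp]: "shuffle 0 p = 0"
  by (simp add: shuffle_def)

lemma shuffle_0_right [simp]: "shuffle p 0 = 0"
  using shuffle_diff_right[of p 0 0] by simp

lemma shuffle_minus_left: "shuffle (- p) r = - shuffle p r"
  using shuffle_diff_left[of 0 p r] by simp

lemma shuffle_minus_right: "shuffle r (- p) = - shuffle r p"
  using shuffle_diff_right[of r 0 p] by simp

lemma shuffle_add_left: "shuffle (p + q) r = shuffle p r + shuffle q r"
  using shuffle_diff_left[of p "- q" r] by (simp add: shuffle_minus_left)

lemma shuffle_add_right: "shuffle r (p + q) = shuffle r p + shuffle r q"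
  using shuffle_diff_right[of r p "- q"] by (simp add: shuffle_minus_right)

lemmas shuffle_linear = shuffle_diff_left shuffle_diff_right shuffle_add_left shuffle_add_right
  shuffle_minus_left shuffle_minus_right

lemma shuffle_1_left [simp]: "shuffle 1 p = p"
proof (induction p rule: frag_induct)
  case (word w)
  show ?case using shuffle_frag_of[of "[]" w] by (simp add: frag_of_Nil)
qed (simp_all add: shuffle_linear)

lemma shuffle_words_Nil_right [simp]: "shuffle_words u [] = frag_of u"
  by (cases u) simp_all

lemma shuffle_1_right [simp]: "shuffle p 1 = p"
proof (induction p rule: frag_induct)
  case (word w)
  show ?case using shuffle_frag_of[of w "[]"] by (simp add: frag_of_Nil)
qed (simp_all add: shuffle_linear)

lemma shuffle_ltr_mult:
  "shuffle (ltr a * p) (ltr b * q) =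
     ltr a * shuffle p (ltr b * q) + ltr b * shuffle (ltr a * p) q"
proof (induction p rule: frag_induct)
  case (word u)
  show ?case
  proof (induction q rule: frag_induct)
    case (word v)
    show ?case
      unfolding frag_of_Cons[symmetric] shuffle_frag_of by simp
  qed (simp_all add: shuffle_linear algebra_simps)
qed (simp_all add: shuffle_linear algebra_simps)

lemma shuffle_commute: "shuffle p q = shuffle q p"
proof (induction p rule: frag_induct)
  case (word u)
  show ?case
  proof (induction q rule: frag_induct)
    case (word v)
    have "shuffle_words u v = shuffle_words v u"
      by (induction u v rule: shuffle_words.induct) (simp_all add: add.commute)
    then show ?case by (simp add: shuffle_frag_of)
  qed (simp_all add: shuffle_linear)
qed (simp_all add: shuffle_linear)

text \<open>Both bracketings expand by which of the three words supplies the first letter.\<close>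

lemma shuffle_assoc_words:
  "shuffle (shuffle (frag_of u) (frag_of v)) (frag_of w) =
   shuffle (frag_of u) (shuffle (frag_of v) (frag_of w))"
proof (induction "length u + length v + length w" arbitrary: u v w rule: less_induct)
  case less
  show ?case
  proof (cases "u = [] \<or> v = [] \<or> w = []")
    case True
    then show ?thesis by (auto simp: frag_of_Nil)
  next
    case False
    then obtain a u' b v' c w' where e: "u = a # u'" "v = b # v'" "w = c # w'"
      by (metis neq_Nil_conv)
    have 1: "shuffle (shuffle (frag_of u') (ltr b * frag_of v')) (ltr c * frag_of w') =
       shuffle (frag_of u') (shuffle (ltr b * frag_of v') (ltr c * frag_of w'))"
      using less[of u' v w] by (simp add: e frag_of_Cons)
    have 2: "shuffle (shuffle (ltr a * frag_of u') (frag_of v')) (ltr c * frag_of w') =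
       shuffle (ltr a * frag_of u') (shuffle (frag_of v') (ltr c * frag_of w'))"
      using less[of u v' w] by (simp add: e frag_of_Cons)
    have 3: "shuffle (shuffle (ltr a * frag_of u') (ltr b * frag_of v')) (frag_of w') =
       shuffle (ltr a * frag_of u') (shuffle (ltr b * frag_of v') (frag_of w'))"
      using less[of u v w'] by (simp add: e frag_of_Cons)
    \<comment> \<open>On the left the terms starting with \<open>c\<close> appear already split, so
      the third hypothesis is prefixed with \<open>ltr c\<close> and expanded along with the
      goal.\<close>
    show ?thesis
      using 1 2 arg_cong[OF 3, of "\<lambda>x. ltr c * x"]
      unfolding e frag_of_Cons
      by (simp add: shuffle_ltr_mult shuffle_linear distrib_left add_ac)
  qed
qed

lemma shuffle_assoc: "shuffle (shuffle p q) r = shuffle p (shuffle q r)"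
proof (induction p rule: frag_induct)
  case (word u)
  show ?case
  proof (induction q rule: frag_induct)
    case (word v)
    show ?case
      by (induction r rule: frag_induct) (simp_all add: shuffle_linear shuffle_assoc_words)
  qed (simp_all add: shuffle_linear)
qed (simp_all add: shuffle_linear)

section \<open>Supports of shuffles and stable subspaces\<close>

lemma keys_shuffle_words: "shuffle_words u v \<in> word_span (shuffles u v)"
proof (induction u v rule: shuffle_words.induct)
  case (3 a u b v)
  then show ?case
    by (auto intro!: word_span_add elim!: word_span_ltr_mult)
qed simp_all

lemma shuffle_closed:
  assumes "p \<in> word_span U" "q \<in> word_span V"
    and "\<And>u v. u \<in> U \<Longrightarrow> v \<in> V \<Longrightarrow> shuffles u v \<subseteq> W"
  shows "shuffle p q \<in> word_span W"
  using assms(1)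
proof (induction p rule: word_span_induct)
  case (word u)
  note u = this
  show ?case using assms(2)
  proof (induction q rule: word_span_induct)
    case (word v)
    show ?case
      using keys_shuffle_words[of u v] word_span_mono[OF assms(3)[OF u word]]
      by (auto simp: shuffle_frag_of)
  qed (simp_all add: shuffle_linear word_span_diff)
qed (simp_all add: shuffle_linear word_span_diff)

lemma hd_shuffles: "w \<in> shuffles u v \<Longrightarrow> w \<noteq> [] \<Longrightarrow> (u \<noteq> [] \<and> hd w = hd u) \<or> (v \<noteq> [] \<and> hd w = hd v)"
  by (induction u v rule: shuffles.induct) auto

lemma last_shuffles:
  "w \<in> shuffles u v \<Longrightarrow> w \<noteq> [] \<Longrightarrow> (u \<noteq> [] \<and> last w = last u) \<or> (v \<noteq> [] \<and> last w = last v)"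
proof (induction u v arbitrary: w rule: shuffles.induct)
  case (3 x xs y ys)
  from "3.prems" consider w' where "w = x # w'" "w' \<in> shuffles xs (y # ys)"
    | w' where "w = y # w'" "w' \<in> shuffles (x # xs) ys" by auto
  then show ?case
  proof cases
    case 1
    moreover have "w' \<noteq> []" using 1 by auto
    ultimately show ?thesis using "3.IH"(1)[of w'] by auto
  next
    case 2
    moreover have "w' \<noteq> []" using 2 by auto
    ultimately show ?thesis using "3.IH"(2)[of w'] by auto
  qed
qed auto

text \<open>In a one-letter word both end conditions fall on the same letter, which leaves just
  \<open>[Lz]\<close>.\<close>

lemma words_z0_iff: "w \<in> words_z0 \<longleftrightarrow> w = [] \<or> (hd w \<noteq> L0 \<and> last w \<noteq> L1)"
proof
  assume r: "w = [] \<or> (hd w \<noteq> L0 \<and> last w \<noteq> L1)"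
  show "w \<in> words_z0"
  proof (cases "length w \<ge> 2")
    case True
    then obtain a v b where "w = [a] @ v @ [b]"
      by (cases w; cases "tl w" rule: rev_cases) auto
    with r show ?thesis by (cases a; cases b) (auto simp: words_z0_def)
  next
    case False
    then consider "w = []" | a where "w = [a]" by (cases w; cases "tl w") auto
    then show ?thesis using r by cases (auto simp: words_z0_def, metis letter.exhaust)
  qed
qed (auto simp: words_z0_def)

lemma words_zm2_iff: "w \<in> words_zm2 \<longleftrightarrow> w = [] \<or> (hd w \<noteq> L0 \<and> last w = L0)"
proof
  assume r: "w = [] \<or> (hd w \<noteq> L0 \<and> last w = L0)"
  show "w \<in> words_zm2"
  proof (cases "length w \<ge> 2")
    case True
    then obtain a v b where "w = [a] @ v @ [b]"
      by (cases w; cases "tl w" rule: rev_cases) auto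
    with r show ?thesis by (cases a; cases b) (auto simp: words_zm2_def)
  next
    case False
    then consider "w = []" | a where "w = [a]" by (cases w; cases "tl w") auto
    then show ?thesis using r by cases (auto simp: words_zm2_def)
  qed
qed (auto simp: words_zm2_def)

lemma words_0_iff: "w \<in> words_0 \<longleftrightarrow> w \<in> words_zm2 \<and> Lz \<notin> set w"
proof -
  have "v \<in> lists {L0, L1} \<longleftrightarrow> Lz \<notin> set v" for v
    using letter.exhaust by (auto simp: in_lists_conv_set)
  then show ?thesis by (auto simp: words_0_def words_zm2_def)
qed

lemma shuffle_Azm2: "p \<in> Azm2 \<Longrightarrow> q \<in> Azm2 \<Longrightarrow> shuffle p q \<in> Azm2"
  unfolding Azm2_def
  by (erule (1) shuffle_closed) (auto simp: words_zm2_iff; metis hd_shuffles last_shuffles)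

lemma shuffle_A0: "p \<in> A0 \<Longrightarrow> q \<in> A0 \<Longrightarrow> shuffle p q \<in> A0"
  unfolding A0_def
  by (erule (1) shuffle_closed)
    (auto simp: words_0_iff words_zm2_iff set_shuffles; metis hd_shuffles last_shuffles)

lemma shuffle_Az0: "p \<in> Az0 \<Longrightarrow> q \<in> Az0 \<Longrightarrow> shuffle p q \<in> Az0"
  unfolding Az0_def
  by (erule (1) shuffle_closed) (auto simp: words_z0_iff; metis hd_shuffles last_shuffles)

lemma A0_subset_Azm2: "A0 \<subseteq> Azm2"
  unfolding A0_def Azm2_def by (rule word_span_mono) (auto simp: words_0_iff)

lemma A0_subset_Az0: "A0 \<subseteq> Az0"
  unfolding A0_def Az0_def by (rule word_span_mono) (auto simp: words_0_iff words_zm2_iff words_z0_iff)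

text \<open>The index \<open>i\<close> counts the letters of \<open>v\<close> that are shuffled to the left of \<open>c\<close>.\<close>

lemma shuffle_words_snoc:
  "shuffle_words (u @ [c]) v =
     (\<Sum>i\<le>length v. shuffle_words u (take i v) * frag_of (c # drop i v))"
proof (induction u v rule: shuffle_words.induct)
  case (1 v)
  show ?case
  proof (induction v)
    case (Cons b v)
    then show ?case
      by (simp add: sum.atMost_Suc_shift frag_of_Cons frag_of_Nil sum_distrib_left mult.assoc
        del: sum.atMost_Suc)
  qed (simp add: frag_of_Nil)
next
  case (2 a u)
  then show ?case by (simp add: frag_of_append[symmetric])
next
  case (3 a u b v)
  then show ?case
    by (simp add: sum.atMost_Suc_shift frag_of_Cons frag_of_append sum_distrib_left mult.assoc
        sum.distrib distrib_right distrib_left frag_of_Nil del: sum.atMost_Suc)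
qed

section \<open>The derivations\<close>

text \<open>\<open>pdiff Lz \<alpha>\<close> is a sum over adjacent pairs of letters. \<open>inner\<close> collects the pairs inside the
  word, \<open>dleft\<close> and \<open>dright\<close> those involving the boundary letters \<open>L0\<close> and \<open>L1\<close>; each of the three
  is a derivation for the shuffle product, for \<open>inner\<close> because \<open>pair_term\<close> is antisymmetric.\<close>

definition pair_term :: "letter \<Rightarrow> letter \<Rightarrow> letter \<Rightarrow> ncpoly" where
  "pair_term \<alpha> a b = (if {a, b} = {Lz, \<alpha>} then ltr b - ltr a else 0)"

lemma pair_term_antisym: "pair_term \<alpha> b a = - pair_term \<alpha> a b"
  by (simp add: pair_term_def insert_commute)

fun inner_word :: "letter \<Rightarrow> letter list \<Rightarrow> ncpoly" where
  "inner_word \<alpha> (a # b # w) = pair_term \<alpha> a b * frag_of w + ltr a * inner_word \<alpha> (b # w)"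
| "inner_word \<alpha> _ = 0"

definition inner :: "letter \<Rightarrow> ncpoly \<Rightarrow> ncpoly" where
  "inner \<alpha> = frag_extend (inner_word \<alpha>)"

text \<open>The pair that \<open>a\<close> forms with the next letter when put in front of a word:
  the defect of \<open>inner\<close> from commuting with the prefix \<open>a\<close>.\<close>

definition contract :: "letter \<Rightarrow> letter \<Rightarrow> ncpoly \<Rightarrow> ncpoly" where
  "contract \<alpha> a = frag_extend (\<lambda>w. case w of [] \<Rightarrow> 0 | b # v \<Rightarrow> pair_term \<alpha> a b * frag_of v)"

definition dleft :: "ncpoly \<Rightarrow> ncpoly" where
  "dleft = frag_extend (\<lambda>w. if w \<noteq> [] \<and> hd w = Lz then frag_of (tl w) else 0)"

definition dright :: "ncpoly \<Rightarrow> ncpoly" where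
  "dright = frag_extend (\<lambda>w. if w \<noteq> [] \<and> last w = Lz then frag_of (butlast w) else 0)"

text \<open>A prefixed letter is also the last one exactly on the empty word;
  \<open>dright_ltr\<close> corrects for this.\<close>

definition counit :: "ncpoly \<Rightarrow> ncpoly" where
  "counit = frag_extend (\<lambda>w. if w = [] then 1 else 0)"

lemmas der_defs = inner_def contract_def dleft_def dright_def counit_def

lemma der_diff:
  "inner \<alpha> (p - q) = inner \<alpha> p - inner \<alpha> q"
  "contract \<alpha> a (p - q) = contract \<alpha> a p - contract \<alpha> a q"
  "dleft (p - q) = dleft p - dleft q"
  "dright (p - q) = dright p - dright q"
  "counit (p - q) = counit p - counit q"
  by (simp_all add: der_defs frag_extend_diff)

lemma der_0 [simp]:
  "inner \<alpha> 0 = 0" "contract \<alpha> a 0 = 0" "dleft 0 = 0" "dright 0 = 0" "counit 0 = 0"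
  by (simp_all add: der_defs)

lemma der_add:
  "inner \<alpha> (p + q) = inner \<alpha> p + inner \<alpha> q"
  "contract \<alpha> a (p + q) = contract \<alpha> a p + contract \<alpha> a q"
  "dleft (p + q) = dleft p + dleft q"
  "dright (p + q) = dright p + dright q"
  "counit (p + q) = counit p + counit q"
  by (simp_all add: der_defs frag_extend_add)

lemma der_1 [simp]:
  "inner \<alpha> 1 = 0" "contract \<alpha> a 1 = 0" "dleft 1 = 0" "dright 1 = 0" "counit 1 = 1"
  by (simp_all add: der_defs frag_of_Nil[symmetric])

lemma inner_ltr: "inner \<alpha> (ltr a * p) = ltr a * inner \<alpha> p + contract \<alpha> a p"
proof (induction p rule: frag_induct)
  case (word w)
  show ?case unfolding frag_of_Cons[symmetric] by (cases w) (simp_all add: der_defs)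
qed (simp_all add: der_diff algebra_simps)

lemma contract_ltr: "contract \<alpha> a (ltr b * p) = pair_term \<alpha> a b * p"
proof (induction p rule: frag_induct)
  case (word w)
  show ?case unfolding frag_of_Cons[symmetric] by (simp add: der_defs)
qed (simp_all add: der_diff algebra_simps)

lemma dleft_ltr: "dleft (ltr a * p) = (if a = Lz then p else 0)"
proof (induction p rule: frag_induct)
  case (word w)
  show ?case unfolding frag_of_Cons[symmetric] by (simp add: der_defs)
qed (simp_all add: der_diff algebra_simps)

lemma counit_word: "counit (frag_of w) = (if w = [] then 1 else 0)"
  by (simp add: counit_def)

lemma counit_ltr: "counit (ltr a * p) = 0"
proof (induction p rule: frag_induct)
  case (word w)
  show ?case unfolding frag_of_Cons[symmetric] by (simp add: der_defs)
qed (simp_all add: der_diff algebra_simps)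

lemma dright_ltr: "dright (ltr a * p) = ltr a * dright p + (if a = Lz then counit p else 0)"
proof (induction p rule: frag_induct)
  case (word w)
  show ?case
    unfolding frag_of_Cons[symmetric] counit_word
    by (simp add: dright_def frag_of_Cons[symmetric] frag_of_Nil)
qed (simp_all add: der_diff algebra_simps)

lemma counit_shuffle_ltr: "counit (shuffle p (ltr b * q)) = 0"
proof (induction p rule: frag_induct)
  case (word w)
  show ?case
    by (cases w) (simp_all add: frag_of_Nil frag_of_Cons shuffle_ltr_mult der_add counit_ltr)
qed (simp_all add: der_diff shuffle_linear)

lemma counit_ltr_shuffle: "counit (shuffle (ltr b * q) p) = 0"
  using counit_shuffle_ltr[of p b q] by (simp add: shuffle_commute)

text \<open>Shuffling \<open>contract \<alpha> a p\<close> with \<open>ltr b * q\<close> also yields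
  words starting with that \<open>b\<close>; these are removed and replaced by the pair of
  \<open>a\<close> with \<open>b\<close>.\<close>

lemma contract_shuffle_ltr:
  "contract \<alpha> a (shuffle p (ltr b * q)) =
     shuffle (contract \<alpha> a p) (ltr b * q) - ltr b * shuffle (contract \<alpha> a p) q
       + pair_term \<alpha> a b * shuffle p q"
proof (induction p rule: frag_induct)
  case (word w)
  show ?case
  proof (cases w)
    case Nil
    then show ?thesis by (simp add: frag_of_Nil contract_ltr)
  next
    case (Cons c u)
    have "shuffle (pair_term \<alpha> a c * frag_of u) (ltr b * q) =
      pair_term \<alpha> a c * shuffle (frag_of u) (ltr b * q)
        + ltr b * shuffle (pair_term \<alpha> a c * frag_of u) q"
      by (simp add: pair_term_def left_diff_distrib right_diff_distrib shuffle_linear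
          shuffle_ltr_mult)
    then show ?thesis
      by (simp add: Cons frag_of_Cons shuffle_ltr_mult der_add contract_ltr)
  qed
qed (simp_all add: der_diff shuffle_linear algebra_simps)

text \<open>Follows the recursion of \<open>shuffle_words\<close>: the premises of
  \<open>step\<close> are the Leibniz rule for its two recursive calls.\<close>

lemma shuffle_derivationI:
  assumes diff: "\<And>p q. d (p - q) = d p - d q"
    and one: "d 1 = 0"
    and step: "\<And>a u b v.
      d (shuffle (frag_of u) (ltr b * frag_of v)) =
        shuffle (d (frag_of u)) (ltr b * frag_of v) + shuffle (frag_of u) (d (ltr b * frag_of v)) \<Longrightarrow>
      d (shuffle (ltr a * frag_of u) (frag_of v)) =
        shuffle (d (ltr a * frag_of u)) (frag_of v) + shuffle (ltr a * frag_of u) (d (frag_of v)) \<Longrightarrow>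
      d (shuffle (ltr a * frag_of u) (ltr b * frag_of v)) =
        shuffle (d (ltr a * frag_of u)) (ltr b * frag_of v)
        + shuffle (ltr a * frag_of u) (d (ltr b * frag_of v))"
  shows "d (shuffle p q) = shuffle (d p) q + shuffle p (d q)"
proof -
  have zero: "d 0 = 0" using diff[of 0 0] by simp
  have words: "d (shuffle (frag_of u) (frag_of v)) =
      shuffle (d (frag_of u)) (frag_of v) + shuffle (frag_of u) (d (frag_of v))" for u v
  proof (induction u v rule: shuffle_words.induct)
    case (3 a u b v)
    then show ?case using step[of u b v a] by (simp add: frag_of_Cons)
  qed (simp_all add: frag_of_Nil one)
  show ?thesis
  proof (induction p rule: frag_induct)
    case (word u)
    show ?case
      by (induction q rule: frag_induct) (simp_all add: words shuffle_linear diff zero)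
  qed (simp_all add: shuffle_linear diff zero)
qed

lemma inner_shuffle: "inner \<alpha> (shuffle p q) = shuffle (inner \<alpha> p) q + shuffle p (inner \<alpha> q)"
proof (rule shuffle_derivationI)
  fix a u b v
  assume IH: "inner \<alpha> (shuffle (frag_of u) (ltr b * frag_of v)) =
        shuffle (inner \<alpha> (frag_of u)) (ltr b * frag_of v)
        + shuffle (frag_of u) (inner \<alpha> (ltr b * frag_of v))"
    "inner \<alpha> (shuffle (ltr a * frag_of u) (frag_of v)) =
        shuffle (inner \<alpha> (ltr a * frag_of u)) (frag_of v)
        + shuffle (ltr a * frag_of u) (inner \<alpha> (frag_of v))"
  \<comment> \<open>Mirror of \<open>contract_shuffle_ltr\<close> with the sign of the pair
    reversed: the pairs formed by \<open>a\<close> and \<open>b\<close> across the two factors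
    cancel.\<close>
  have c: "contract \<alpha> b (shuffle (ltr a * frag_of u) (frag_of v)) =
      shuffle (ltr a * frag_of u) (contract \<alpha> b (frag_of v))
      - ltr a * shuffle (frag_of u) (contract \<alpha> b (frag_of v))
      - pair_term \<alpha> a b * shuffle (frag_of u) (frag_of v)"
    using contract_shuffle_ltr[of \<alpha> b "frag_of v" a "frag_of u"] pair_term_antisym[of \<alpha> b a]
    by (simp add: shuffle_commute)
  show "inner \<alpha> (shuffle (ltr a * frag_of u) (ltr b * frag_of v)) =
        shuffle (inner \<alpha> (ltr a * frag_of u)) (ltr b * frag_of v)
        + shuffle (ltr a * frag_of u) (inner \<alpha> (ltr b * frag_of v))"
    using IH
    by (simp add: shuffle_ltr_mult der_add inner_ltr c contract_shuffle_ltr shuffle_linear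
        algebra_simps)
qed (simp_all add: der_diff)

lemma dleft_shuffle: "dleft (shuffle p q) = shuffle (dleft p) q + shuffle p (dleft q)"
  by (rule shuffle_derivationI) (simp_all add: der_diff der_add dleft_ltr shuffle_ltr_mult)

lemma dright_shuffle: "dright (shuffle p q) = shuffle (dright p) q + shuffle p (dright q)"
proof (rule shuffle_derivationI)
  fix a u b v
  assume IH: "dright (shuffle (frag_of u) (ltr b * frag_of v)) =
        shuffle (dright (frag_of u)) (ltr b * frag_of v)
        + shuffle (frag_of u) (dright (ltr b * frag_of v))"
    "dright (shuffle (ltr a * frag_of u) (frag_of v)) =
        shuffle (dright (ltr a * frag_of u)) (frag_of v)
        + shuffle (ltr a * frag_of u) (dright (frag_of v))"
  show "dright (shuffle (ltr a * frag_of u) (ltr b * frag_of v)) =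
        shuffle (dright (ltr a * frag_of u)) (ltr b * frag_of v)
        + shuffle (ltr a * frag_of u) (dright (ltr b * frag_of v))"
    using IH
    by (simp add: shuffle_ltr_mult der_add dright_ltr counit_shuffle_ltr counit_ltr_shuffle counit_word
        shuffle_linear algebra_simps)
qed (simp_all add: der_diff)

text \<open>Letting the left boundary letter vary makes the derivation recursive in the word.\<close>

definition pdiff_from :: "letter \<Rightarrow> letter \<Rightarrow> letter list \<Rightarrow> ncpoly" where
  "pdiff_from \<alpha> c w =
     (\<Sum>i = 1..length w.
        frag_cmul (of_bool ({(c # w @ [L1]) ! i, (c # w @ [L1]) ! (i + 1)} = {Lz, \<alpha>})
            - of_bool ({(c # w @ [L1]) ! (i - 1), (c # w @ [L1]) ! i} = {Lz, \<alpha>}))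
          (frag_of (take (i - 1) w @ drop i w)))"

text \<open>Only the deletion of the first letter sees \<open>c\<close>; in all later ones
  \<open>a\<close> stays in front and acts as left boundary. For empty \<open>w\<close>,
  \<open>hd (w @ [L1])\<close> is the right boundary letter.\<close>

lemma pdiff_from_Cons:
  "pdiff_from \<alpha> c (a # w) =
     frag_cmul (of_bool ({a, hd (w @ [L1])} = {Lz, \<alpha>}) - of_bool ({c, a} = {Lz, \<alpha>})) (frag_of w)
     + ltr a * pdiff_from \<alpha> a w"
proof -
  let ?f = "\<lambda>c w i. frag_cmul (of_bool ({(c # w @ [L1]) ! i, (c # w @ [L1]) ! (i + 1)} = {Lz, \<alpha>})
            - of_bool ({(c # w @ [L1]) ! (i - 1), (c # w @ [L1]) ! i} = {Lz, \<alpha>}))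
          (frag_of (take (i - 1) w @ drop i w))"
  \<comment> \<open>As a linear extension, prefixing \<open>a\<close> commutes with integer
    coefficients.\<close>
  have ext: "ltr a * p = frag_extend (\<lambda>w. frag_of (a # w)) p" for p
    by (induction p rule: frag_induct) (simp_all add: frag_of_Cons frag_extend_diff right_diff_distrib)
  have cm: "ltr a * frag_cmul k p = frag_cmul k (ltr a * p)" for k p
    by (simp add: ext frag_extend_cmul)
  have "pdiff_from \<alpha> c (a # w) = ?f c (a # w) 1 + (\<Sum>i = 2..Suc (length w). ?f c (a # w) i)"
    unfolding pdiff_from_def by (subst sum.atLeast_Suc_atMost) (simp_all add: numeral_2_eq_2)
  also have "(\<Sum>i = 2..Suc (length w). ?f c (a # w) i) = (\<Sum>i = 1..length w. ?f c (a # w) (Suc i))"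
    using sum.shift_bounds_cl_Suc_ivl[of "?f c (a # w)" 1 "length w"] by (simp add: numeral_2_eq_2)
  also have "\<dots> = (\<Sum>i = 1..length w. ltr a * ?f a w i)"
  proof (rule sum.cong[OF refl])
    fix i assume "i \<in> {1..length w}"
    then obtain j where "i = Suc j" by (cases i) auto
    then show "?f c (a # w) (Suc i) = ltr a * ?f a w i"
      by (simp add: cm frag_of_Cons)
  qed
  finally show ?thesis
    by (simp add: pdiff_from_def sum_distrib_left hd_conv_nth)
qed

lemma pdiff_word_eq_pdiff_from: "pdiff_word Lz \<alpha> w = pdiff_from \<alpha> L0 w"
  by (simp add: pdiff_word_def pdiff_from_def Let_def)

text \<open>Regroups the deletions by adjacent pair: deleting the left member counts
  \<open>+1\<close>, the right member \<open>-1\<close>. An inner pair gives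
  \<open>pair_term\<close>; a boundary pair has a single deletable member, whence the two
  signs.\<close>

lemma pdiff_from_eq:
  "pdiff_from \<alpha> c w = inner_word \<alpha> w
     - (if w \<noteq> [] \<and> {c, hd w} = {Lz, \<alpha>} then frag_of (tl w) else 0)
     + (if w \<noteq> [] \<and> {last w, L1} = {Lz, \<alpha>} then frag_of (butlast w) else 0)"
proof (induction w arbitrary: c)
  case Nil
  then show ?case by (simp add: pdiff_from_def)
next
  case (Cons a w)
  have [simp]: "pdiff_from \<alpha> x [] = 0" for x
    by (simp add: pdiff_from_def)
  show ?case
  proof (cases w)
    case Nil
    then show ?thesis by (simp add: pdiff_from_Cons)
  next
    case (Cons b v)
    define X where "X = (if {last w, L1} = {Lz, \<alpha>} then frag_of (butlast w) else 0)"
    have IH: "pdiff_from \<alpha> a w =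
        inner_word \<alpha> w - (if {a, b} = {Lz, \<alpha>} then frag_of v else 0) + X"
      using Cons.IH[of a] Cons by (simp add: X_def)
    have X: "(if a # w \<noteq> [] \<and> {last (a # w), L1} = {Lz, \<alpha>} then frag_of (butlast (a # w)) else 0)
        = ltr a * X"
      by (simp add: X_def Cons frag_of_Cons)
    have eq: "pdiff_from \<alpha> c (a # w) =
        frag_cmul (of_bool ({a, b} = {Lz, \<alpha>}) - of_bool ({c, a} = {Lz, \<alpha>})) (frag_of w)
        + ltr a * (inner_word \<alpha> w - (if {a, b} = {Lz, \<alpha>} then frag_of v else 0)) + ltr a * X"
      unfolding pdiff_from_Cons[of \<alpha> c a w] IH by (simp add: distrib_left Cons)
    show ?thesis
      unfolding X eq by (simp add: Cons pair_term_def frag_of_Cons algebra_simps)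
  qed
qed

text \<open>The left boundary letter \<open>L0\<close> matters only for \<alpha> =
  \<open>L0\<close>, the right one \<open>L1\<close> only for \<alpha> = \<open>L1\<close>.\<close>

lemma pdiff_eq:
  assumes "\<alpha> \<in> {L0, L1}"
  shows "pdiff Lz \<alpha> p = inner \<alpha> p - (if \<alpha> = L0 then dleft p else 0) + (if \<alpha> = L1 then dright p else 0)"
proof (induction p rule: frag_induct)
  case (word w)
  show ?case
    using assms
    by (auto simp: pdiff_def pdiff_word_eq_pdiff_from pdiff_from_eq der_defs doubleton_eq_iff)
qed (simp_all add: pdiff_def frag_extend_diff der_diff)

lemma pdiff_shuffle:
  "\<alpha> \<in> {L0, L1} \<Longrightarrow> pdiff Lz \<alpha> (shuffle p q) = shuffle (pdiff Lz \<alpha> p) q + shuffle p (pdiff Lz \<alpha> q)"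
  by (auto simp: pdiff_eq inner_shuffle dleft_shuffle dright_shuffle shuffle_linear)

lemma pdiff_0 [simp]: "pdiff \<alpha> \<beta> 0 = 0"
  by (simp add: pdiff_def)

lemma pdiff_diff: "pdiff \<alpha> \<beta> (p - q) = pdiff \<alpha> \<beta> p - pdiff \<alpha> \<beta> q"
  by (simp add: pdiff_def frag_extend_diff)

lemma inner_word_no_z: "Lz \<notin> set w \<Longrightarrow> inner_word \<alpha> w = 0"
  by (induction \<alpha> w rule: inner_word.induct) (auto simp: pair_term_def doubleton_eq_iff)

lemma pdiff_no_z:
  assumes "\<alpha> \<in> {L0, L1}" "p \<in> word_span {w. Lz \<notin> set w}"
  shows "pdiff Lz \<alpha> p = 0"
  using assms(2)
proof (induction p rule: word_span_induct)
  case (word w)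
  then have "w \<noteq> [] \<longrightarrow> hd w \<noteq> Lz \<and> last w \<noteq> Lz"
    by (metis hd_in_set last_in_set mem_Collect_eq)
  then show ?case
    using assms(1) word by (auto simp: pdiff_eq der_defs inner_word_no_z)
qed (simp_all add: pdiff_diff)

section \<open>Constant parts and standard relations\<close>

lemma Const_diff: "Const (p - q) = Const p - Const q"
  by (simp add: Const_def frag_extend_diff)

lemma Const_add: "Const (p + q) = Const p + Const q"
  by (simp add: Const_def frag_extend_add)

lemma Const_0 [simp]: "Const 0 = 0"
  by (simp add: Const_def)

lemma Const_ltr: "Const (ltr a * p) = (if a = Lz then 0 else ltr a * Const p)"
proof (induction p rule: frag_induct)
  case (word w)
  show ?case unfolding frag_of_Cons[symmetric] by (simp add: Const_def frag_of_Cons[symmetric])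
qed (simp_all add: Const_diff right_diff_distrib)

lemma Const_1 [simp]: "Const 1 = 1"
  by (simp add: Const_def frag_of_Nil[symmetric])

lemma Const_shuffle: "Const (shuffle p q) = shuffle (Const p) (Const q)"
proof -
  have words: "Const (shuffle (frag_of u) (frag_of v)) = shuffle (Const (frag_of u)) (Const (frag_of v))"
    for u v
  proof (induction u v rule: shuffle_words.induct)
    case (3 a u b v)
    then show ?case
      by (simp add: frag_of_Cons shuffle_ltr_mult Const_add Const_ltr split: if_splits)
  qed (simp_all add: frag_of_Nil)
  show ?thesis
  proof (induction p rule: frag_induct)
    case (word u)
    show ?case
      by (induction q rule: frag_induct) (simp_all add: words shuffle_linear Const_diff)
  qed (simp_all add: shuffle_linear Const_diff)
qed

lemma Const_no_z: "p \<in> word_span {w. Lz \<notin> set w} \<Longrightarrow> Const p = p"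
  by (induction p rule: word_span_induct) (simp_all add: Const_diff, simp add: Const_def)

lemma A0_no_z: "A0 \<subseteq> word_span {w. Lz \<notin> set w}"
  unfolding A0_def by (rule word_span_mono) (auto simp: words_0_iff)

text \<open>Each \<open>pdiff Lz \<alpha>\<close> with \<alpha> in \<open>{L0, L1}\<close> vanishes
  on \<open>A0\<close>, so by the Leibniz rule \<open>u\<close> passes through every iterated
  derivation, and \<open>Const\<close> respects shuffles.\<close>

lemma I_ST_shuffle:
  assumes "u \<in> A0" "x \<in> I_ST"
  shows "shuffle u x \<in> I_ST"
proof -
  have u: "u \<in> word_span {w. Lz \<notin> set w}" using assms(1) A0_no_z by blast
  have "foldr (pdiff Lz) \<alpha>s (shuffle u x) = shuffle u (foldr (pdiff Lz) \<alpha>s x)"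
    if "\<alpha>s \<in> lists {L0, L1}" for \<alpha>s
    using that by (induction \<alpha>s) (simp_all add: pdiff_shuffle pdiff_no_z[OF _ u])
  then show ?thesis
    using assms A0_subset_Az0 by (auto simp: I_ST_def Const_shuffle shuffle_Az0 subset_iff)
qed

lemma I_ST_diff:
  assumes "x \<in> I_ST" "y \<in> I_ST"
  shows "x - y \<in> I_ST"
proof -
  have "foldr (pdiff Lz) \<alpha>s (x - y) = foldr (pdiff Lz) \<alpha>s x - foldr (pdiff Lz) \<alpha>s y" for \<alpha>s
    by (induction \<alpha>s) (simp_all add: pdiff_diff)
  then show ?thesis
    using assms by (auto simp: I_ST_def Const_diff Az0_def word_span_diff)
qed

lemma I_ST_0 [simp]: "0 \<in> I_ST"
proof -
  have "foldr (pdiff Lz) \<alpha>s 0 = 0" for \<alpha>s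
    by (induction \<alpha>s) simp_all
  then show ?thesis by (simp add: I_ST_def Az0_def)
qed

text \<open>Every nonempty iterate starts with a first derivative of \<open>x\<close>, which is
  zero.\<close>

lemma I_STI:
  assumes "x \<in> Az0" "Const x = 0" "pdiff Lz L0 x = 0" "pdiff Lz L1 x = 0"
  shows "x \<in> I_ST"
proof -
  have "Const (foldr (pdiff Lz) \<alpha>s x) = 0 \<and> (\<alpha>s \<noteq> [] \<longrightarrow> foldr (pdiff Lz) \<alpha>s x = 0)"
    if "\<alpha>s \<in> lists {L0, L1}" for \<alpha>s
    using that
  proof (induction \<alpha>s)
    case (Cons a as)
    then show ?case using assms by (cases "as = []") auto
  qed (simp add: assms)
  then show ?thesis using assms(1) by (auto simp: I_ST_def)
qed

section \<open>The duality maps\<close>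

lemma antihom_ext_0 [simp]: "antihom_ext f 0 = 0"
  by (simp add: antihom_ext_def)

lemma antihom_ext_Nil [simp]: "antihom_ext f (frag_of []) = 1"
  by (simp add: antihom_ext_def)

lemma antihom_ext_1 [simp]: "antihom_ext f 1 = 1"
  using antihom_ext_Nil[of f] by (simp only: frag_of_Nil)

lemma antihom_ext_Cons [simp]:
  "antihom_ext f (frag_of (a # w)) = antihom_ext f (frag_of w) * f a"
  by (simp add: antihom_ext_def)

lemma antihom_ext_ltr [simp]: "antihom_ext f (ltr a) = f a"
  by (simp add: ltr_def)

lemma antihom_ext_diff: "antihom_ext f (p - q) = antihom_ext f p - antihom_ext f q"
  by (simp add: antihom_ext_def frag_extend_diff)

lemma antihom_ext_mult: "antihom_ext f (p * q) = antihom_ext f q * antihom_ext f p"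
proof (induction p rule: frag_induct)
  case (word u)
  show ?case
  proof (induction q rule: frag_induct)
    case (word v)
    show ?case unfolding frag_of_append[symmetric] by (simp add: antihom_ext_def)
  qed (simp_all add: antihom_ext_diff algebra_simps)
qed (simp_all add: antihom_ext_diff algebra_simps)

section \<open>The specialization of e_z to e_1\<close>

lemma lambda'_0 [simp]: "lambda' 0 = 0"
  by (simp add: lambda'_def hom_ext_def)

lemma lambda'_1 [simp]: "lambda' 1 = 1"
  by (simp add: lambda'_def hom_ext_def frag_of_Nil[symmetric])

lemma lambda'_diff: "lambda' (p - q) = lambda' p - lambda' q"
  by (simp add: lambda'_def hom_ext_def frag_extend_diff)

lemma lambda'_add: "lambda' (p + q) = lambda' p + lambda' q"
  by (simp add: lambda'_def hom_ext_def frag_extend_add)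

lemma lambda'_ltr: "lambda' (ltr a) = ltr (if a = L0 then L0 else L1)"
  by (cases a) (simp_all add: lambda'_def hom_ext_def ltr_def)

lemma lambda'_mult: "lambda' (p * q) = lambda' p * lambda' q"
proof (induction p rule: frag_induct)
  case (word u)
  show ?case
  proof (induction q rule: frag_induct)
    case (word v)
    show ?case unfolding frag_of_append[symmetric] by (simp add: lambda'_def hom_ext_def)
  qed (simp_all add: lambda'_diff algebra_simps)
qed (simp_all add: lambda'_diff algebra_simps)

lemma lambda'_word: "lambda' (frag_of w) = frag_of (map (\<lambda>a. if a = L0 then L0 else L1) w)"
  by (induction w) (simp_all add: frag_of_Nil frag_of_Cons lambda'_mult lambda'_ltr)

lemma lambda'_shuffle: "lambda' (shuffle p q) = shuffle (lambda' p) (lambda' q)"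
proof -
  have words: "lambda' (shuffle (frag_of u) (frag_of v)) = shuffle (lambda' (frag_of u)) (lambda' (frag_of v))"
    for u v
  proof (induction u v rule: shuffle_words.induct)
    case (3 a u b v)
    then show ?case
      by (simp add: frag_of_Cons shuffle_ltr_mult lambda'_add lambda'_mult lambda'_ltr)
  qed (simp_all add: frag_of_Nil)
  show ?thesis
  proof (induction p rule: frag_induct)
    case (word u)
    show ?case
      by (induction q rule: frag_induct) (simp_all add: words shuffle_linear lambda'_diff)
  qed (simp_all add: shuffle_linear lambda'_diff)
qed

lemma lambda'_A0:
  assumes "p \<in> A0" shows "lambda' p = p"
proof -
  have "p \<in> word_span {w. Lz \<notin> set w}" using assms A0_no_z by blast
  then show ?thesis
  proof (induction p rule: word_span_induct)
    case (word w)
    then have "map (\<lambda>a. if a = L0 then L0 else L1) w = w"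
      by (intro map_idI) (metis letter.exhaust mem_Collect_eq)
    then show ?case by (simp add: lambda'_word)
  qed (simp_all add: lambda'_diff)
qed

text \<open>For \<open>a\<close> equal to \<open>L0\<close> or \<open>L1\<close>,
  \<open>tau_z\<close> takes \<open>ltr a\<close> to \<open>ltr Lz - ltr (swap01 a)\<close> and
  \<open>tau_inf\<close> takes it to \<open>- ltr (swap01 a)\<close>; hence the products
  \<open>zprod\<close> and \<open>negprod\<close> below.\<close>

definition swap01 :: "letter \<Rightarrow> letter" where
  "swap01 a = (case a of L0 \<Rightarrow> L1 | L1 \<Rightarrow> L0 | Lz \<Rightarrow> Lz)"

definition zprod :: "letter list \<Rightarrow> ncpoly" where
  "zprod bs = prod_list (map (\<lambda>b. ltr Lz - ltr b) bs)"

definition negprod :: "letter list \<Rightarrow> ncpoly" where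
  "negprod bs = prod_list (map (\<lambda>b. - ltr b) bs)"

lemma zprod_simps [simp]: "zprod [] = 1" "zprod (b # bs) = (ltr Lz - ltr b) * zprod bs"
  by (simp_all add: zprod_def)

lemma negprod_simps [simp]: "negprod [] = 1" "negprod (b # bs) = - ltr b * negprod bs"
  by (simp_all add: negprod_def)

lemma tau_z_word:
  "Lz \<notin> set w \<Longrightarrow> tau_z (frag_of w) = zprod (map swap01 (rev w))"
proof (induction w)
  case (Cons a w)
  then show ?case by (cases a) (simp_all add: tau_z_def zprod_def swap01_def)
qed (simp add: tau_z_def)

lemma tau_inf_word:
  "Lz \<notin> set w \<Longrightarrow> tau_inf (frag_of w) = negprod (map swap01 (rev w))"
proof (induction w)
  case (Cons a w)
  then show ?case by (cases a) (simp_all add: tau_inf_def negprod_def swap01_def)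
qed (simp add: tau_inf_def)

lemma zprod_span: "zprod bs \<in> word_span {v. list_all2 (\<lambda>x b. x = Lz \<or> x = b) v bs}"
proof (induction bs)
  case Nil
  show ?case by (simp add: frag_of_Nil[symmetric])
next
  case (Cons b bs)
  show ?case
    unfolding zprod_simps left_diff_distrib
    by (intro word_span_diff word_span_ltr_mult[OF Cons]) simp_all
qed

lemma negprod_eq: "negprod bs = frag_of bs \<or> negprod bs = - frag_of bs"
  by (induction bs) (auto simp: frag_of_Nil frag_of_Cons)

text \<open>Interior runs of letters different from \<open>\<alpha>\<close> are shortened once from each side with
  opposite signs, so that only the outermost runs contribute.\<close>

lemma inner_zprod:
  assumes "bs \<noteq> []" "set bs \<subseteq> {L0, L1}" "\<alpha> \<in> {L0, L1}"
  shows "inner \<alpha> (zprod bs) = (if hd bs \<noteq> \<alpha> then zprod (tl bs) else 0)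
     - (if last bs \<noteq> \<alpha> then zprod (butlast bs) else 0)"
  using assms(1,2)
proof (induction bs rule: list_nonempty_induct)
  case (single b)
  show ?case
    using inner_ltr[of \<alpha> Lz 1] inner_ltr[of \<alpha> b 1] by (simp add: der_diff)
next
  case (cons b bs)
  then obtain c cs where bs: "bs = c # cs" by (cases bs) auto
  define X where "X = (if last bs \<noteq> \<alpha> then zprod (butlast bs) else 0)"
  have IH: "inner \<alpha> (zprod bs) = (if c \<noteq> \<alpha> then zprod cs else 0) - X"
    using cons.IH cons.prems by (simp add: bs X_def)
  have X: "(if last (b # bs) \<noteq> \<alpha> then zprod (butlast (b # bs)) else 0) = (ltr Lz - ltr b) * X"
    by (simp add: X_def bs)
  have "inner \<alpha> (zprod (b # bs)) = (ltr Lz - ltr b) * inner \<alpha> (zprod bs)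
      + (contract \<alpha> Lz (zprod bs) - contract \<alpha> b (zprod bs))"
    by (simp add: left_diff_distrib der_diff inner_ltr)
  also have "contract \<alpha> Lz (zprod bs) - contract \<alpha> b (zprod bs)
      = - (pair_term \<alpha> Lz c * zprod cs) - pair_term \<alpha> b Lz * zprod cs"
  proof -
    have "pair_term \<alpha> Lz Lz = 0" "pair_term \<alpha> b c = 0"
      using cons.prems assms(3) by (auto simp: bs pair_term_def doubleton_eq_iff)
    then show ?thesis by (simp add: bs left_diff_distrib der_diff contract_ltr)
  qed
  finally have eq: "inner \<alpha> (zprod (b # bs)) =
      (ltr Lz - ltr b) * (if c \<noteq> \<alpha> then zprod cs else 0) - (ltr Lz - ltr b) * X
      - pair_term \<alpha> Lz c * zprod cs - pair_term \<alpha> b Lz * zprod cs"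
    by (simp add: IH right_diff_distrib)
  have "b \<in> {L0, L1}" "c \<in> {L0, L1}" using cons.prems by (auto simp: bs)
  then show ?case
    unfolding X eq using assms(3)
    by (auto simp: bs pair_term_def doubleton_eq_iff left_diff_distrib)
qed

lemma dleft_zprod: "bs \<noteq> [] \<Longrightarrow> Lz \<notin> set bs \<Longrightarrow> dleft (zprod bs) = zprod (tl bs)"
  by (cases bs) (auto simp: left_diff_distrib der_diff dleft_ltr)

lemma counit_zprod: "counit (zprod bs) = (if bs = [] then 1 else 0)"
  by (cases bs) (simp_all add: left_diff_distrib der_diff counit_ltr)

lemma dright_zprod: "bs \<noteq> [] \<Longrightarrow> Lz \<notin> set bs \<Longrightarrow> dright (zprod bs) = zprod (butlast bs)"
  by (induction bs rule: list_nonempty_induct)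
    (auto simp: left_diff_distrib der_diff dright_ltr counit_zprod
      dright_ltr[of _ 1, simplified])

text \<open>Setting e_z to zero leaves \<open>- ltr b\<close> of each factor; so
  \<open>tau_inf\<close> is the constant part of \<open>tau_z\<close> on words without
  \<open>Lz\<close>.\<close>

lemma Const_zprod: "Lz \<notin> set bs \<Longrightarrow> Const (zprod bs) = negprod bs"
  by (induction bs) (auto simp: left_diff_distrib Const_diff Const_ltr)

section \<open>Standard relations from dual words\<close>

lemma words_0_nonempty:
  assumes "w \<in> words_0" "w \<noteq> []"
  shows "Lz \<notin> set w" "hd w = L1" "last w = L0"
proof -
  show z: "Lz \<notin> set w" "last w = L0" using assms by (auto simp: words_0_iff words_zm2_iff)
  have "hd w \<noteq> L0" using assms by (auto simp: words_0_iff words_zm2_iff)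
  moreover have "hd w \<noteq> Lz" using z(1) hd_in_set[OF assms(2)] by metis
  ultimately show "hd w = L1" by (cases "hd w") auto
qed

text \<open>Reversal exchanges the two ends and \<open>swap01\<close> exchanges their letters, so
  the end letters are preserved.\<close>

lemma dual_word:
  assumes "w \<in> words_0" "w \<noteq> []"
  defines "bs \<equiv> map swap01 (rev w)"
  shows "bs \<noteq> []" "hd bs = L1" "last bs = L0" "set bs \<subseteq> {L0, L1}"
proof -
  note w = words_0_nonempty[OF assms(1,2)]
  show "bs \<noteq> []" "hd bs = L1" "last bs = L0"
    using w assms(2) by (simp_all add: bs_def hd_map last_map hd_rev last_rev swap01_def)
  show "set bs \<subseteq> {L0, L1}"
    using w(1) by (auto simp: bs_def swap01_def split: letter.splits)
qed

lemma tau_inf_A0_word: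
  assumes "w \<in> words_0" shows "tau_inf (frag_of w) \<in> A0"
proof (cases "w = []")
  case True
  then show ?thesis using assms by (simp add: tau_inf_def A0_def frag_of_Nil[symmetric])
next
  case False
  have "map swap01 (rev w) \<in> words_0"
    using dual_word[OF assms False] by (auto simp: words_0_iff words_zm2_iff)
  then show ?thesis
    using negprod_eq[of "map swap01 (rev w)"] tau_inf_word[OF words_0_nonempty(1)[OF assms False]]
    by (auto simp: A0_def word_span_uminus)
qed

lemma tau_z_minus_tau_inf_I_ST:
  assumes "w \<in> words_0"
  shows "tau_z (frag_of w) - tau_inf (frag_of w) \<in> I_ST"
proof (cases "w = []")
  case True
  then show ?thesis by (simp add: tau_z_def tau_inf_def)
next
  case False
  define bs where "bs = map swap01 (rev w)"
  note bs = dual_word(1-3)[OF assms False, folded bs_def]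
  have set: "set bs \<subseteq> {L0, L1}"
    using dual_word(4)[OF assms False] by (simp add: bs_def)
  then have z: "Lz \<notin> set bs" by auto
  have tz: "tau_z (frag_of w) = zprod bs" "tau_inf (frag_of w) = negprod bs"
    using words_0_nonempty(1)[OF assms False] by (simp_all add: tau_z_word tau_inf_word bs_def)
  have inf: "negprod bs \<in> A0" using tau_inf_A0_word[OF assms] tz by simp
  have inf': "negprod bs \<in> word_span {w. Lz \<notin> set w}" using inf A0_no_z by blast
  \<comment> \<open>Each end of \<open>v\<close> is that of \<open>bs\<close> or \<open>Lz\<close>,
    and both are admissible.\<close>
  have "v \<in> words_z0" if "list_all2 (\<lambda>x b. x = Lz \<or> x = b) v bs" for v
  proof -
    have "v \<noteq> []" using that bs(1) by auto
    have "length v = length bs" using that by (rule list_all2_lengthD)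
    moreover have "v ! i = Lz \<or> v ! i = bs ! i" if "i < length bs" for i
      using list_all2_nthD2[OF \<open>list_all2 _ v bs\<close> that] .
    ultimately have "hd v = Lz \<or> hd v = hd bs" "last v = Lz \<or> last v = last bs"
      using bs(1) \<open>v \<noteq> []\<close> by (simp_all add: hd_conv_nth last_conv_nth)
    then show ?thesis using bs by (auto simp: words_z0_iff)
  qed
  then have "{v. list_all2 (\<lambda>x b. x = Lz \<or> x = b) v bs} \<subseteq> words_z0" by blast
  then have "zprod bs \<in> Az0"
    unfolding Az0_def by (rule subsetD[OF word_span_mono zprod_span])
  moreover have "negprod bs \<in> Az0" using inf A0_subset_Az0 by blast
  moreover have "pdiff Lz \<alpha> (zprod bs - negprod bs) = 0" if "\<alpha> \<in> {L0, L1}" for \<alpha>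
  proof -
    \<comment> \<open>For \<alpha> = \<open>L0\<close> the interior part leaves
      \<open>zprod (tl bs)\<close>, cancelled by \<open>dleft\<close>; for \<alpha> =
      \<open>L1\<close> it leaves \<open>- zprod (butlast bs)\<close>, cancelled by
      \<open>dright\<close>.\<close>
    have "pdiff Lz \<alpha> (zprod bs) = 0"
      using that bs(2,3)
      unfolding pdiff_eq[OF that] inner_zprod[OF bs(1) set that] dleft_zprod[OF bs(1) z]
        dright_zprod[OF bs(1) z]
      by auto
    then show ?thesis by (simp add: pdiff_diff pdiff_no_z[OF that inf'])
  qed
  moreover have "Const (zprod bs - negprod bs) = 0"
    by (simp add: Const_diff Const_zprod[OF z] Const_no_z[OF inf'])
  ultimately show ?thesis
    unfolding tz Az0_def by (intro I_STI) (simp_all add: Az0_def word_span_diff)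
qed

section \<open>Regularization\<close>

lemma frag_extend_frag_extend: "frag_extend f (frag_extend g p) = frag_extend (\<lambda>x. frag_extend f (g x)) p"
  by (induction p rule: frag_induct) (simp_all add: frag_extend_diff)

lemma lookup_frag_restrict:
  "Poly_Mapping.lookup (frag_extend (\<lambda>x. if P x then frag_of x else 0) p) k =
     (if P k then Poly_Mapping.lookup p k else 0)"
  by (induction p rule: frag_induct) (auto simp: frag_extend_diff lookup_minus)

text \<open>Among the terms of the shuffle of \<open>u\<close> and \<open>v\<close> only \<open>u @ v\<close> has a part after its last \<open>L0\<close>
  that is as long as \<open>v\<close>, so the tensors with \<open>v\<close> of maximal length can be read off.\<close>

definition split_tail :: "nat \<Rightarrow> letter list \<Rightarrow> ncpoly2" where
  "split_tail n w = (let y = rev (takeWhile (\<lambda>a. a \<noteq> L0) (rev w)) in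
     if length y = n then frag_of (take (length w - length y) w, y) else 0)"

lemma split_tail_append:
  assumes "L0 \<notin> set y" "u = [] \<or> last u = L0"
  shows "split_tail n (u @ y) = (if length y = n then frag_of (u, y) else 0)"
proof -
  have "takeWhile (\<lambda>a. a \<noteq> L0) (rev (u @ y)) = rev y"
    using assms by (cases u rule: rev_cases) (auto simp: takeWhile_append)
  then show ?thesis by (simp add: split_tail_def)
qed

lemma split_tail_shuffle:
  assumes "u \<in> words_zm2" "L0 \<notin> set v" "length v \<le> n"
  shows "frag_extend (split_tail n) (shuffle_words u v) = (if length v = n then frag_of (u, v) else 0)"
proof (cases u rule: rev_cases)
  case Nil
  then show ?thesis using split_tail_append[OF assms(2), of "[]" n] by simp
next
  case (snoc x c)
  then have c: "c = L0" using assms(1) by (auto simp: words_zm2_iff)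
  \<comment> \<open>Here at least one letter of \<open>v\<close> precedes the final
    \<open>L0\<close> of \<open>u\<close>, so fewer than \<open>n\<close> letters follow it.\<close>
  have low: "frag_extend (split_tail n) (p * frag_of (L0 # drop (Suc i) v)) = 0" if "i < length v" for p i
  proof (induction p rule: frag_induct)
    case (word w)
    have "L0 \<notin> set (drop (Suc i) v)" using assms(2) in_set_dropD by metis
    then show ?case
      using that assms(3) split_tail_append[of "drop (Suc i) v" "w @ [L0]" n]
      unfolding frag_of_append[symmetric] by simp
  qed (simp_all add: left_diff_distrib frag_extend_diff)
  have "shuffle_words u v = frag_of (u @ v)
      + (\<Sum>i<length v. shuffle_words x (take (Suc i) v) * frag_of (L0 # drop (Suc i) v))"
    by (simp add: snoc c shuffle_words_snoc sum.atMost_shift frag_of_append frag_of_Cons mult.assoc)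
  then show ?thesis
    using split_tail_append[OF assms(2), of u n] snoc c
    by (simp add: frag_extend_add frag_extend_sum o_def low)
qed

lemma shuffle_tensor_diff: "shuffle_tensor (S - T) = shuffle_tensor S - shuffle_tensor T"
  by (simp add: shuffle_tensor_def frag_extend_diff)

text \<open>Triangularity: with \<open>n\<close> the maximal length of a second factor,
  \<open>split_tail n\<close> recovers the top part of \<open>T\<close> from its image, and that
  part is nonzero if \<open>T\<close> is.\<close>

lemma shuffle_tensor_eq_0:
  assumes "T \<in> word_span (words_zm2 \<times> lists {L1, Lz})" "shuffle_tensor T = 0"
  shows "T = 0"
proof (rule ccontr)
  assume "T \<noteq> 0"
  then have ne: "Poly_Mapping.keys T \<noteq> {}" by simp
  define n where "n = Max ((\<lambda>x. length (snd x)) ` Poly_Mapping.keys T)"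
  have "n \<in> (\<lambda>x. length (snd x)) ` Poly_Mapping.keys T"
    unfolding n_def by (rule Max_in) (use ne in auto)
  then obtain k where k: "k \<in> Poly_Mapping.keys T" "length (snd k) = n" by auto
  have le: "length (snd x) \<le> n" if "x \<in> Poly_Mapping.keys T" for x
    unfolding n_def by (rule Max_ge) (use that in auto)
  have "0 = frag_extend (split_tail n) (shuffle_tensor T)"
    using assms(2) by simp
  also have "\<dots> = frag_extend (\<lambda>x. frag_extend (split_tail n) (shuffle_words (fst x) (snd x))) T"
    by (simp add: shuffle_tensor_def frag_extend_frag_extend case_prod_beta shuffle_frag_of)
  also have "\<dots> = frag_extend (\<lambda>x. if length (snd x) = n then frag_of x else 0) T"
  proof (rule frag_extend_eq)
    fix x assume x: "x \<in> Poly_Mapping.keys T"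
    then have "fst x \<in> words_zm2" "L0 \<notin> set (snd x)"
      using assms(1) by (auto simp: word_span_def in_lists_conv_set dest!: subsetD)
    then show "frag_extend (split_tail n) (shuffle_words (fst x) (snd x)) =
        (if length (snd x) = n then frag_of x else 0)"
      using split_tail_shuffle[OF _ _ le[OF x]] by simp
  qed
  finally have "Poly_Mapping.lookup (0 :: ncpoly2) k = Poly_Mapping.lookup T k"
    using lookup_frag_restrict[of "\<lambda>x. length (snd x) = n" T k] k(2) by simp
  then show False using k(1) by (simp add: in_keys_iff)
qed

lemma inj_on_shuffle_tensor: "inj_on shuffle_tensor (word_span (words_zm2 \<times> lists {L1, Lz}))"
proof (rule inj_onI)
  fix S T
  assume "S \<in> word_span (words_zm2 \<times> lists {L1, Lz})" "T \<in> word_span (words_zm2 \<times> lists {L1, Lz})"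
    and "shuffle_tensor S = shuffle_tensor T"
  then have "S - T = 0"
    by (intro shuffle_tensor_eq_0) (simp_all add: word_span_diff shuffle_tensor_diff)
  then show "S = T" by simp
qed

lemma shuffle_tensor_tensor: "shuffle_tensor (tensor (frag_of u) q) = shuffle (frag_of u) q"
  by (induction q rule: frag_induct)
    (simp_all add: tensor_def shuffle_tensor_def frag_extend_diff shuffle_linear)

abbreviation words_z1 :: "letter list set" where
  "words_z1 \<equiv> words_z0 \<inter> lists {L1, Lz}"

text \<open>The graph of \<open>N_map\<close> and, below, of \<open>id_const \<circ> reg_z\<close>, generated from the values on
  shuffles, which determine these maps by injectivity of \<open>shuffle_tensor\<close>.\<close>

inductive N_rel :: "ncpoly \<Rightarrow> ncpoly \<Rightarrow> bool" where
  zero: "N_rel 0 0"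
| word: "u \<in> words_zm2 \<Longrightarrow> v \<in> words_z1 \<Longrightarrow>
    N_rel (shuffle (frag_of u) (frag_of v)) (shuffle (frag_of u) (tau_z (frag_of v)))"
| diff: "N_rel x y \<Longrightarrow> N_rel x' y' \<Longrightarrow> N_rel (x - x') (y - y')"

inductive reg_rel :: "ncpoly \<Rightarrow> ncpoly \<Rightarrow> bool" where
  zero: "reg_rel 0 0"
| word: "u \<in> words_zm2 \<Longrightarrow>
    reg_rel (shuffle (frag_of u) (frag_of (replicate k Lz))) (if k = 0 then frag_of u else 0)"
| diff: "reg_rel x r \<Longrightarrow> reg_rel x' r' \<Longrightarrow> reg_rel (x - x') (r - r')"

text \<open>A tensor preimage is built along the rules of \<open>N_rel\<close>; injectivity
  identifies it with the one chosen by \<open>reg_z1\<close>.\<close>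

lemma N_map_eqI:
  assumes "N_rel x y" shows "N_map x = y"
proof -
  have "\<exists>T \<in> word_span (words_zm2 \<times> words_z1).
      shuffle_tensor T = x \<and> shuffle_tensor (id_tensor tau_z T) = y"
    using assms
  proof induction
    case zero
    show ?case by (rule bexI[of _ 0]) (simp_all add: shuffle_tensor_def id_tensor_def)
  next
    case (word u v)
    then show ?case
      by (intro bexI[of _ "frag_of (u, v)"])
        (auto simp: id_tensor_def shuffle_tensor_tensor, simp add: shuffle_tensor_def)
  next
    case (diff x y x' y')
    then obtain S T where "S \<in> word_span (words_zm2 \<times> words_z1)" "T \<in> word_span (words_zm2 \<times> words_z1)"
      "shuffle_tensor S = x" "shuffle_tensor (id_tensor tau_z S) = y"
      "shuffle_tensor T = x'" "shuffle_tensor (id_tensor tau_z T) = y'" by blast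
    then show ?case
      by (intro bexI[of _ "S - T"])
        (simp_all add: word_span_diff shuffle_tensor_diff id_tensor_def frag_extend_diff)
  qed
  then obtain T where T: "T \<in> word_span (words_zm2 \<times> words_z1)" "shuffle_tensor T = x"
    "shuffle_tensor (id_tensor tau_z T) = y" by blast
  have "inj_on shuffle_tensor (word_span (words_zm2 \<times> words_z1))"
    by (rule inj_on_subset[OF inj_on_shuffle_tensor word_span_mono]) auto
  then have "reg_z1 x = T"
    unfolding reg_z1_def T(2)[symmetric] using T(1) by (rule inv_into_f_f)
  then show ?thesis by (simp add: N_map_def T(3))
qed

lemma id_const_reg_z_eqI:
  assumes "reg_rel x r" shows "id_const (reg_z x) = r"
proof -
  have "\<exists>T \<in> word_span (words_zm2 \<times> lists {Lz}). shuffle_tensor T = x \<and> id_const T = r"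
    using assms
  proof induction
    case zero
    show ?case by (rule bexI[of _ 0]) (simp_all add: shuffle_tensor_def id_const_def)
  next
    case (word u k)
    then show ?case
      by (intro bexI[of _ "frag_of (u, replicate k Lz)"])
        (auto simp: id_const_def shuffle_tensor_def const_term_def)
  next
    case (diff x y x' y')
    then obtain S T where "S \<in> word_span (words_zm2 \<times> lists {Lz})" "T \<in> word_span (words_zm2 \<times> lists {Lz})"
      "shuffle_tensor S = x" "id_const S = y" "shuffle_tensor T = x'" "id_const T = y'" by blast
    then show ?case
      by (intro bexI[of _ "S - T"])
        (simp_all add: word_span_diff shuffle_tensor_diff id_const_def frag_extend_diff)
  qed
  then obtain T where T: "T \<in> word_span (words_zm2 \<times> lists {Lz})" "shuffle_tensor T = x"
    "id_const T = r" by blast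
  have "inj_on shuffle_tensor (word_span (words_zm2 \<times> lists {Lz}))"
    by (rule inj_on_subset[OF inj_on_shuffle_tensor word_span_mono]) auto
  then have "reg_z x = T"
    unfolding reg_z_def T(2)[symmetric] using T(1) by (rule inv_into_f_f)
  then show ?thesis by (simp add: T(3))
qed

section \<open>Compatibility of the regularization graphs with shuffles\<close>

lemma tau_z_diff: "tau_z (p - q) = tau_z p - tau_z q"
  by (simp add: tau_z_def antihom_ext_diff)

lemma tau_z_mult: "tau_z (p * q) = tau_z q * tau_z p"
  by (simp add: tau_z_def antihom_ext_mult)

lemma tau_z_0 [simp]: "tau_z 0 = 0"
  by (simp add: tau_z_def)

lemma tau_z_1 [simp]: "tau_z 1 = 1"
  by (simp add: tau_z_def)

lemma tau_z_ltr [simp]: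
  "tau_z (ltr L0) = ltr Lz - ltr L1" "tau_z (ltr L1) = ltr Lz - ltr L0" "tau_z (ltr Lz) = ltr Lz"
  by (simp_all add: tau_z_def)

lemma N_rel_shuffle:
  assumes "p \<in> Azm2" "q \<in> word_span words_z1"
  shows "N_rel (shuffle p q) (shuffle p (tau_z q))"
  using assms(1) unfolding Azm2_def
proof (induction p rule: word_span_induct)
  case (word u)
  note u = this
  show ?case using assms(2)
    by (induction q rule: word_span_induct)
      (auto simp: shuffle_linear tau_z_diff intro: N_rel.intros u)
qed (auto simp: shuffle_linear intro: N_rel.intros)

text \<open>By associativity \<open>u\<close> merges into the \<open>Azm2\<close> factor of each
  generator.\<close>

lemma N_rel_shuffle_left:
  assumes "N_rel x y" "u \<in> Azm2"
  shows "N_rel (shuffle u x) (shuffle u y)"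
  using assms(1)
proof induction
  case (word u' v)
  have "shuffle u (frag_of u') \<in> Azm2" "frag_of v \<in> word_span words_z1"
    using word assms(2) by (auto simp: Azm2_def intro!: shuffle_Azm2[unfolded Azm2_def])
  from N_rel_shuffle[OF this] show ?case by (simp add: shuffle_assoc)
qed (auto simp: shuffle_linear intro: N_rel.intros)

lemma reg_rel_shuffle:
  assumes "p \<in> Azm2"
  shows "reg_rel (shuffle p (frag_of (replicate k Lz))) (if k = 0 then p else 0)"
  using assms unfolding Azm2_def
proof (induction p rule: word_span_induct)
  case (diff p q)
  then have "reg_rel (shuffle p (frag_of (replicate k Lz)) - shuffle q (frag_of (replicate k Lz)))
    ((if k = 0 then p else 0) - (if k = 0 then q else 0))" by (rule reg_rel.diff)
  then show ?case by (simp add: shuffle_linear split: if_splits)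
next
  case (word w)
  then show ?case by (rule reg_rel.word)
qed (simp add: reg_rel.zero)

lemma reg_rel_Azm2: "p \<in> Azm2 \<Longrightarrow> reg_rel p p"
  using reg_rel_shuffle[of p 0] by (simp add: frag_of_Nil)

lemma reg_rel_shuffle_left:
  assumes "reg_rel x r" "u \<in> Azm2"
  shows "reg_rel (shuffle u x) (shuffle u r)"
  using assms(1)
proof induction
  case (word u' k)
  have "shuffle u (frag_of u') \<in> Azm2"
    using word assms(2) by (auto simp: Azm2_def intro!: shuffle_Azm2[unfolded Azm2_def])
  from reg_rel_shuffle[OF this, of k] show ?case
    by (cases "k = 0") (simp_all add: shuffle_assoc)
qed (auto simp: shuffle_linear intro: reg_rel.intros)

section \<open>Peeling off the part after the last e_0\<close>

lemma shuffle_snoc: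
  "shuffle (p * ltr c) (frag_of v) =
     (\<Sum>i\<le>length v. shuffle p (frag_of (take i v)) * frag_of (c # drop i v))"
proof (induction p rule: frag_induct)
  case (word w)
  show ?case
    using shuffle_words_snoc[of w c v]
    by (simp add: shuffle_frag_of[symmetric] frag_of_append ltr_def del: mult_single)
qed (simp_all add: left_diff_distrib shuffle_linear sum_subtractf)

text \<open>In \<open>shuffle_snoc\<close> the summand for \<open>i = 0\<close> is
  \<open>q * frag_of (L0 # y)\<close> and all others have a shorter tail. Solving for it, by
  induction on the tail, passes from shuffles to concatenations. \<open>S\<close> will be the domain
  of \<open>reg_rel\<close>, later the elements related to 0 by \<open>lambda_rel\<close>.\<close>

lemma mult_L0_tail_mem:
  fixes S X :: "ncpoly set"
  assumes S: "0 \<in> S" "\<And>x y. x \<in> S \<Longrightarrow> y \<in> S \<Longrightarrow> x - y \<in> S"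
    and X: "\<And>q y i. q \<in> X \<Longrightarrow> y \<in> Y \<Longrightarrow> shuffle q (frag_of (take i y)) \<in> X"
    and Y: "\<And>y i. y \<in> Y \<Longrightarrow> drop i y \<in> Y"
    and XY: "\<And>q y. q \<in> X \<Longrightarrow> y \<in> Y \<Longrightarrow> shuffle (q * ltr L0) (frag_of y) \<in> S"
    and "q \<in> X" "y \<in> Y"
  shows "q * frag_of (L0 # y) \<in> S"
  using assms(6,7)
proof (induction "length y" arbitrary: q y rule: less_induct)
  case less
  let ?f = "\<lambda>i. shuffle q (frag_of (take i y)) * frag_of (L0 # drop i y)"
  have sum: "sum ?f (Suc ` I) \<in> S" if "finite I" "I \<subseteq> {..<length y}" for I
    using that
  proof (induction I)
    case (insert i I)
    have "?f (Suc i) \<in> S"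
      using insert.prems less.prems by (intro less.hyps X Y) auto
    moreover have "sum ?f (Suc ` insert i I) = ?f (Suc i) + sum ?f (Suc ` I)"
      using insert.hyps by (simp add: image_iff)
    ultimately show ?case
      using insert minus_closed_imp_plus_closed[of S] S by auto
  qed (simp add: S)
  have "{..length y} = insert 0 (Suc ` {..<length y})"
    by (simp add: lessThan_Suc_atMost[symmetric] lessThan_Suc_eq_insert_0)
  then have "shuffle (q * ltr L0) (frag_of y) = ?f 0 + sum ?f (Suc ` {..<length y})"
    unfolding shuffle_snoc by simp
  then have "q * frag_of (L0 # y) = shuffle (q * ltr L0) (frag_of y) - sum ?f (Suc ` {..<length y})"
    by (simp add: frag_of_Nil)
  then show ?case using S(2) XY less.prems sum[of "{..<length y}"] by simp
qed

text \<open>Precisely the prefixes that land in \<open>words_zm2\<close> once \<open>L0\<close> is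
  appended.\<close>

definition words_hd :: "letter list set" where
  "words_hd = {w. w \<noteq> [] \<and> hd w \<noteq> L0}"

lemma shuffle_words_hd:
  assumes "q \<in> word_span words_hd" "L0 \<notin> set y"
  shows "shuffle q (frag_of y) \<in> word_span words_hd"
proof (rule shuffle_closed[OF assms(1)])
  show "frag_of y \<in> word_span {y}" by simp
  fix u v assume uv: "u \<in> words_hd" "v \<in> {y}"
  show "shuffles u v \<subseteq> words_hd"
  proof
    fix w assume w: "w \<in> shuffles u v"
    then have "w \<noteq> []" using uv(1) by (auto simp: words_hd_def)
    then have "hd w = hd u \<or> (y \<noteq> [] \<and> hd w = hd y)"
      using hd_shuffles[OF w] uv(2) by auto
    moreover have "hd y \<noteq> L0" if "y \<noteq> []"
      using hd_in_set[OF that] assms(2) by metis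
    ultimately show "w \<in> words_hd"
      using uv(1) \<open>w \<noteq> []\<close> by (auto simp: words_hd_def)
  qed
qed

lemma mult_L0_Azm2:
  assumes "q \<in> word_span words_hd" shows "q * ltr L0 \<in> Azm2"
  using word_span_mult_frag[OF assms, of "[L0]" words_zm2]
  by (auto simp: words_hd_def words_zm2_iff Azm2_def ltr_def)

text \<open>Cut at the last \<open>L0\<close>: what follows is a power of e_z, so
  \<open>mult_L0_tail_mem\<close> applies. Without \<open>L0\<close> the word is itself a power of
  e_z.\<close>

lemma reg_rel_word:
  assumes "v \<in> lists {L0, Lz}" "v = [] \<or> hd v = Lz"
  shows "\<exists>r. reg_rel (frag_of v) r"
proof (cases "L0 \<in> set v")
  case True
  then obtain u y where v: "v = u @ L0 # y" "L0 \<notin> set y" by (meson split_list_last)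
  have "set y \<subseteq> {L0, Lz}" using assms(1) v(1) by (auto simp: in_lists_conv_set)
  then have "\<forall>a\<in>set y. a = Lz" using v(2) by blast
  then have y: "y = replicate (length y) Lz" by (simp add: replicate_eqI)
  have "u \<in> words_hd" using assms(2) v(1) by (cases u) (auto simp: words_hd_def)
  have "frag_of u * frag_of (L0 # y) \<in> {x. \<exists>r. reg_rel x r}"
  proof (rule mult_L0_tail_mem[where X = "word_span words_hd" and Y = "range (\<lambda>k. replicate k Lz)"])
    show "frag_of u \<in> word_span words_hd" using \<open>u \<in> words_hd\<close> by simp
    show "y \<in> range (\<lambda>k. replicate k Lz)" using y by blast
  next
    fix q y i
    assume "q \<in> word_span words_hd" "y \<in> range (\<lambda>k. replicate k Lz)"
    then show "shuffle q (frag_of (take i y)) \<in> word_span words_hd"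
      by (intro shuffle_words_hd) (auto dest: in_set_takeD)
  next
    fix q y
    assume "q \<in> word_span words_hd" "y \<in> range (\<lambda>k. replicate k Lz)"
    then show "shuffle (q * ltr L0) (frag_of y) \<in> {x. \<exists>r. reg_rel x r}"
      using reg_rel_shuffle[OF mult_L0_Azm2] by blast
  qed (auto intro: reg_rel.intros)
  then show ?thesis by (simp add: v(1) frag_of_append)
next
  case False
  then have "\<forall>a\<in>set v. a = Lz" using assms(1) by (auto simp: in_lists_conv_set)
  then have "v = replicate (length v) Lz" by (simp add: replicate_eqI)
  then have "reg_rel (frag_of v) (if length v = 0 then frag_of [] else 0)"
    using reg_rel.word[of "[]" "length v"] by (simp add: words_zm2_iff frag_of_Nil)
  then show ?thesis by blast
qed

text \<open>A nonempty word of \<open>words_z1\<close> ends in \<open>Lz\<close>, and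
  \<open>tau_z\<close> reverses.\<close>

lemma tau_z_words_z1:
  assumes "v \<in> words_z1"
  shows "tau_z (frag_of v) \<in> word_span {w \<in> lists {L0, Lz}. w = [] \<or> hd w = Lz}"
proof (cases v rule: rev_cases)
  case Nil
  then show ?thesis by (simp add: frag_of_Nil) (simp add: frag_of_Nil[symmetric])
next
  case (snoc u c)
  then have c: "c = Lz" and u: "u \<in> lists {L1, Lz}" using assms by (auto simp: words_z0_iff)
  have "tau_z (frag_of u) \<in> word_span (lists {L0, Lz})"
    using u
  proof (induction u rule: rev_induct)
    case Nil
    then show ?case by (simp add: frag_of_Nil) (simp add: frag_of_Nil[symmetric])
  next
    case (snoc a u)
    then have "ltr x * tau_z (frag_of u) \<in> word_span (lists {L0, Lz})" if "x \<in> {L0, Lz}" for x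
      using that by (intro word_span_ltr_mult[of _ "lists {L0, Lz}"]) auto
    moreover have "tau_z (frag_of (u @ [a])) = tau_z (ltr a) * tau_z (frag_of u)"
      by (simp only: frag_of_append tau_z_mult ltr_def)
    ultimately show ?case
      using snoc.prems by (auto simp: left_diff_distrib intro!: word_span_diff)
  qed
  then have "ltr Lz * tau_z (frag_of u) \<in> word_span {w \<in> lists {L0, Lz}. w = [] \<or> hd w = Lz}"
    by (rule word_span_ltr_mult) auto
  moreover have "tau_z (frag_of v) = tau_z (ltr c) * tau_z (frag_of u)"
    by (simp only: snoc frag_of_append tau_z_mult ltr_def)
  ultimately show ?thesis by (simp add: c)
qed

text \<open>Existence is all that \<open>lambda_rel_L0_tail\<close> asks: there the value is
  shuffled with an element killed by \<open>lambda'\<close>.\<close>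

lemma reg_rel_tau_z:
  assumes "v \<in> words_z1" shows "\<exists>r. reg_rel (tau_z (frag_of v)) r"
  using tau_z_words_z1[OF assms]
  by (induction rule: word_span_induct) (auto intro: reg_rel.intros reg_rel_word)

text \<open>Relational form of \<open>lambda_map\<close>: additivity and shuffle compatibility
  follow from the generating rules, whereas the chosen inverses conceal them.\<close>

definition lambda_rel :: "ncpoly \<Rightarrow> ncpoly \<Rightarrow> bool" where
  "lambda_rel x p \<longleftrightarrow> (\<exists>y r. N_rel x y \<and> reg_rel y r \<and> lambda' r = p)"

lemma lambda_map_eqI: "lambda_rel x p \<Longrightarrow> lambda_map x = p"
  by (auto simp: lambda_rel_def lambda_map_def dest: N_map_eqI id_const_reg_z_eqI)

lemma lambda_relI: "N_rel x y \<Longrightarrow> reg_rel y r \<Longrightarrow> lambda' r = p \<Longrightarrow> lambda_rel x p"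
  by (auto simp: lambda_rel_def)

lemma lambda_relE:
  assumes "lambda_rel x p"
  obtains y r where "N_rel x y" "reg_rel y r" "lambda' r = p"
  using assms by (auto simp: lambda_rel_def)

lemma lambda_rel_0: "lambda_rel 0 0"
  by (rule lambda_relI[OF N_rel.zero reg_rel.zero lambda'_0])

lemma lambda_rel_diff:
  assumes "lambda_rel x p" "lambda_rel y q"
  shows "lambda_rel (x - y) (p - q)"
proof -
  obtain x' r y' s where r: "N_rel x x'" "reg_rel x' r" "lambda' r = p"
    and s: "N_rel y y'" "reg_rel y' s" "lambda' s = q"
    using assms by (auto elim!: lambda_relE)
  show ?thesis
    by (rule lambda_relI[OF N_rel.diff[OF r(1) s(1)] reg_rel.diff[OF r(2) s(2)]])
      (simp add: lambda'_diff r(3) s(3))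
qed

lemma lambda_rel_shuffle_left:
  assumes "lambda_rel x p" "u \<in> A0"
  shows "lambda_rel (shuffle u x) (shuffle u p)"
proof -
  obtain y r where r: "N_rel x y" "reg_rel y r" "lambda' r = p"
    using assms(1) by (rule lambda_relE)
  have u: "u \<in> Azm2" using assms(2) A0_subset_Azm2 by blast
  show ?thesis
    by (rule lambda_relI[OF N_rel_shuffle_left[OF r(1) u] reg_rel_shuffle_left[OF r(2) u]])
      (simp add: lambda'_shuffle r(3) lambda'_A0 assms(2))
qed

section \<open>Elements with known image under lambda\<close>

lemma words_z1_Nil: "[] \<in> words_z1"
  by (simp add: words_z0_iff)

lemma one_in_word_span: "[] \<in> W \<Longrightarrow> (1 :: ncpoly) \<in> word_span W"
  by (simp add: frag_of_Nil[symmetric])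

lemma N_rel_Azm2: "p \<in> Azm2 \<Longrightarrow> N_rel p p"
  using N_rel_shuffle[of p 1] one_in_word_span[OF words_z1_Nil] by simp

lemma N_rel_words_z1:
  assumes "q \<in> word_span words_z1" shows "N_rel q (tau_z q)"
proof -
  have "1 \<in> Azm2" by (simp add: Azm2_def one_in_word_span words_zm2_iff)
  from N_rel_shuffle[OF this assms] show ?thesis by simp
qed

lemma lambda_rel_A0:
  assumes "p \<in> A0" shows "lambda_rel p p"
proof -
  have "p \<in> Azm2" using assms A0_subset_Azm2 by blast
  then show ?thesis
    using assms by (intro lambda_relI[OF N_rel_Azm2 reg_rel_Azm2] lambda'_A0)
qed

text \<open>On \<open>shuffle (q * ltr L0) (frag_of y)\<close> duality and regularization act on
  \<open>y\<close> alone, and \<open>lambda'\<close> kills the other factor. The condition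
  \<open>lambda' q = 0\<close> survives shuffling, so \<open>mult_L0_tail_mem\<close> carries this
  over to concatenation.\<close>

lemma lambda_rel_L0_tail:
  assumes "q \<in> word_span words_hd" "lambda' q = 0" "y \<in> words_z1"
  shows "lambda_rel (q * frag_of (L0 # y)) 0"
proof -
  have "q * frag_of (L0 # y) \<in> {x. lambda_rel x 0}"
  proof (rule mult_L0_tail_mem[where X = "{q \<in> word_span words_hd. lambda' q = 0}" and Y = words_z1])
    fix q y i
    assume q: "q \<in> {q \<in> word_span words_hd. lambda' q = 0}" and y: "y \<in> words_z1"
    then have "L0 \<notin> set (take i y)" by (auto simp: in_lists_conv_set dest!: in_set_takeD)
    then show "shuffle q (frag_of (take i y)) \<in> {q \<in> word_span words_hd. lambda' q = 0}"
      using q by (simp add: shuffle_words_hd lambda'_shuffle)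
  next
    fix y i
    assume y: "y \<in> words_z1"
    then have L: "drop i y \<in> lists {L1, Lz}" by (auto simp: in_lists_conv_set dest: in_set_dropD)
    show "drop i y \<in> words_z1"
    proof (cases "drop i y = []")
      case True
      then show ?thesis using words_z1_Nil by simp
    next
      case False
      then have "last (drop i y) = last y" "y \<noteq> []" by (auto simp: last_drop)
      moreover have "hd (drop i y) \<noteq> L0"
        using L False by (cases "drop i y") auto
      ultimately show ?thesis using L False y by (auto simp: words_z0_iff)
    qed
  next
    fix q y
    assume q: "q \<in> {q \<in> word_span words_hd. lambda' q = 0}" and y: "y \<in> words_z1"
    then have m2: "q * ltr L0 \<in> Azm2" by (simp add: mult_L0_Azm2)
    obtain r where r: "reg_rel (tau_z (frag_of y)) r" using reg_rel_tau_z[OF y] by blast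
    have "lambda' (shuffle (q * ltr L0) r) = 0"
      using q by (simp add: lambda'_shuffle lambda'_mult)
    then show "shuffle (q * ltr L0) (frag_of y) \<in> {x. lambda_rel x 0}"
      using N_rel_shuffle[OF m2, of "frag_of y"] reg_rel_shuffle_left[OF r m2] y
      unfolding lambda_rel_def by auto
  qed (use assms lambda_rel_0 lambda_rel_diff[of _ 0 _ 0] in auto)
  then show ?thesis by simp
qed

text \<open>\<open>tau_z\<close> followed by the projection \<open>L0 \<mapsto> 0\<close>.\<close>

definition tau_zp :: "ncpoly \<Rightarrow> ncpoly" where
  "tau_zp = antihom_ext (\<lambda>a. case a of L0 \<Rightarrow> ltr Lz - ltr L1 | L1 \<Rightarrow> ltr Lz | Lz \<Rightarrow> ltr Lz)"

lemma tau_z_frag_of_Cons: "tau_z (frag_of (a # w)) = tau_z (frag_of w) * tau_z (ltr a)"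
  by (simp add: tau_z_def)

lemma tau_zp_frag_of_Cons:
  "tau_zp (frag_of (a # w)) = tau_zp (frag_of w) * (if a = L0 then ltr Lz - ltr L1 else ltr Lz)"
  by (cases a) (simp_all add: tau_zp_def)

lemma tau_zp_span: "tau_zp (frag_of w) \<in> word_span (lists {L1, Lz})"
proof (induction w)
  case Nil
  show ?case by (simp add: tau_zp_def frag_of_Nil[symmetric])
next
  case (Cons a w)
  have "tau_zp (frag_of w) * ltr x \<in> word_span (lists {L1, Lz})" if "x \<in> {L1, Lz}" for x
    unfolding ltr_def using that by (intro word_span_mult_frag[OF Cons]) auto
  then show ?case
    by (cases a) (auto simp: tau_zp_def right_diff_distrib intro!: word_span_diff)
qed

text \<open>\<open>tau_z\<close> sends \<open>ltr Lz - ltr L1\<close> to \<open>ltr L0\<close> and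
  fixes \<open>ltr Lz\<close>; the two reversals cancel.\<close>

lemma tau_z_tau_zp:
  "Lz \<notin> set w \<Longrightarrow> tau_z (tau_zp (frag_of w)) = frag_of (map (\<lambda>a. if a = L0 then L0 else Lz) w)"
proof (induction w)
  case Nil
  show ?case by (simp add: tau_zp_def frag_of_Nil)
next
  case (Cons a w)
  then show ?case
    unfolding tau_zp_frag_of_Cons
    by (cases a) (simp_all add: tau_z_mult tau_z_diff frag_of_Cons)
qed

lemma lambda'_tau_z:
  assumes "L0 \<in> set w" shows "lambda' (tau_z (frag_of w)) = 0"
proof -
  obtain u v where "w = u @ [L0] @ v" using split_list[OF assms] by auto
  then have "tau_z (frag_of w) = tau_z (frag_of v) * (tau_z (ltr L0) * tau_z (frag_of u))"
    by (simp only: frag_of_append tau_z_mult ltr_def mult.assoc)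
  then show ?thesis by (simp add: lambda'_mult lambda'_diff lambda'_ltr)
qed

lemma tau_z_words_hd:
  assumes "Lz \<notin> set w" "w \<noteq> []" "last w = L0"
  shows "tau_z (frag_of w) \<in> word_span words_hd"
proof -
  obtain u where u: "w = u @ [L0]" using assms(2,3) by (metis append_butlast_last_id)
  have "{v. list_all2 (\<lambda>x b. x = Lz \<or> x = b) v (map swap01 (rev w))} \<subseteq> words_hd"
    by (auto simp: u words_hd_def swap01_def list_all2_Cons2)
  then show ?thesis
    unfolding tau_z_word[OF assms(1)] by (rule subsetD[OF word_span_mono zprod_span])
qed

text \<open>As \<open>tau_z\<close> reverses, the image of the first letter stands next to
  \<open>y\<close> and is absorbed into it; hence the general tail.\<close>

lemma lambda_rel_tau_z_diff_tail:
  assumes "w \<noteq> []" "Lz \<notin> set w" "last w = L0" "y \<in> lists {L1, Lz}" "y \<noteq> []" "last y = Lz"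
  shows "lambda_rel ((tau_z (frag_of w) - tau_zp (frag_of w)) * frag_of y) 0"
  using assms
proof (induction w arbitrary: y rule: list_nonempty_induct)
  case (single a)
  \<comment> \<open>The word is \<open>[L0]\<close>, on which the two maps agree.\<close>
  then show ?case
    by (simp add: tau_z_frag_of_Cons tau_zp_frag_of_Cons)
      (simp add: tau_z_def tau_zp_def lambda_rel_0)
next
  case (cons a w)
  let ?d = "tau_z (frag_of w) - tau_zp (frag_of w)"
  have w: "Lz \<notin> set w" "last w = L0" using cons.prems cons.hyps by auto
  have IH: "lambda_rel (?d * frag_of (x # y)) 0" if "x \<in> {L1, Lz}" for x
    using that cons.prems by (intro cons.IH w) auto
  have "hd y \<noteq> L0" using cons.prems by (cases y) auto
  then have "y \<in> words_z1" using cons.prems by (auto simp: words_z0_iff)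
  moreover have "L0 \<in> set w" using w(2) cons.hyps last_in_set by metis
  ultimately have tail: "lambda_rel (tau_z (frag_of w) * frag_of (L0 # y)) 0"
    using w cons.hyps by (intro lambda_rel_L0_tail tau_z_words_hd lambda'_tau_z) auto
  show ?case
  proof (cases a)
    case L0
    have "(tau_z (frag_of (a # w)) - tau_zp (frag_of (a # w))) * frag_of y
        = ?d * frag_of (Lz # y) - ?d * frag_of (L1 # y)"
      unfolding tau_z_frag_of_Cons tau_zp_frag_of_Cons frag_of_Cons[of _ y]
      by (simp add: L0 algebra_simps)
    then show ?thesis using lambda_rel_diff[OF IH[of Lz] IH[of L1]] by simp
  next
    case L1
    \<comment> \<open>The last factor of \<open>tau_z\<close> is \<open>ltr Lz - ltr L0\<close>,
      that of \<open>tau_zp\<close> is \<open>ltr Lz\<close>; the extra \<open>L0\<close> gives the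
      term covered by \<open>tail\<close>.\<close>
    have "(tau_z (frag_of (a # w)) - tau_zp (frag_of (a # w))) * frag_of y
        = ?d * frag_of (Lz # y) - tau_z (frag_of w) * frag_of (L0 # y)"
      unfolding tau_z_frag_of_Cons tau_zp_frag_of_Cons frag_of_Cons[of _ y]
      by (simp add: L1 algebra_simps)
    then show ?thesis using lambda_rel_diff[OF IH[of Lz] tail] by simp
  next
    case Lz
    then show ?thesis using cons.prems by simp
  qed
qed

text \<open>The leading \<open>L1\<close> of \<open>w\<close> supplies a last factor
  \<open>ltr Lz - ltr L0\<close>, hence the nonempty tail needed above. Only
  \<open>tau_zp (frag_of w)\<close> survives.\<close>

lemma lambda_rel_tau_z:
  assumes "w \<in> words_0"
  shows "lambda_rel (tau_z (frag_of w)) (frag_of w)"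
proof (cases "w = []")
  case True
  then show ?thesis
    using lambda_rel_A0[of 1] assms
    by (simp add: frag_of_Nil A0_def one_in_word_span)
next
  case False
  note w = words_0_nonempty[OF assms False]
  then obtain v where wv: "w = L1 # v" using False by (cases w) auto
  have v: "v \<noteq> []" "last v = L0" "Lz \<notin> set v" using w by (auto simp: wv split: if_splits)
  let ?d = "tau_z (frag_of v) - tau_zp (frag_of v)"
  have 1: "lambda_rel (?d * frag_of [Lz]) 0"
    using v by (intro lambda_rel_tau_z_diff_tail) auto
  have "L0 \<in> set v" using v(1,2) last_in_set by metis
  then have 2: "lambda_rel (tau_z (frag_of v) * frag_of [L0]) 0"
    using v words_z1_Nil by (intro lambda_rel_L0_tail tau_z_words_hd lambda'_tau_z) auto
  have 3: "lambda_rel (tau_zp (frag_of w)) (frag_of w)"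
  proof -
    \<comment> \<open>This word is \<open>tau_z (tau_zp (frag_of w))\<close>; it lies in
      \<open>words_zm2\<close>, so regularization keeps it, and \<open>lambda'\<close> turns
      \<open>Lz\<close> back into \<open>L1\<close>.\<close>
    let ?m = "map (\<lambda>a. if a = L0 then L0 else Lz) w"
    have "tau_zp (frag_of v) * frag_of [Lz] \<in> word_span words_z1"
    proof (rule word_span_mult_frag[OF tau_zp_span])
      fix u assume u: "u \<in> lists {L1, Lz}"
      then have "u \<noteq> [] \<Longrightarrow> hd u \<noteq> L0" by (cases u) auto
      then show "u @ [Lz] \<in> words_z1" using u by (cases u) (auto simp: words_z0_iff)
    qed
    moreover have "tau_zp (frag_of w) = tau_zp (frag_of v) * frag_of [Lz]"
      unfolding wv tau_zp_frag_of_Cons by (simp add: ltr_def)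
    ultimately have N: "N_rel (tau_zp (frag_of w)) (frag_of ?m)"
      using N_rel_words_z1[of "tau_zp (frag_of w)"] tau_z_tau_zp[OF w(1)] by simp
    have "?m \<in> words_zm2"
      using w False by (auto simp: words_zm2_iff hd_map last_map)
    then have "reg_rel (frag_of ?m) (frag_of ?m)" by (intro reg_rel_Azm2) (simp add: Azm2_def)
    moreover have "lambda' (frag_of ?m) = frag_of w"
    proof -
      have "map (\<lambda>a. if a = L0 then L0 else L1) ?m = w"
        unfolding map_map using w(1)
        by (intro map_idI) (auto simp: o_def, metis letter.exhaust)
      then show ?thesis by (simp only: lambda'_word)
    qed
    ultimately show ?thesis using N unfolding lambda_rel_def by blast
  qed
  \<comment> \<open>The last summand enters as a double difference because \<open>lambda_rel\<close>
    is known to be closed under differences.\<close>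
  have "tau_z (frag_of w) = (?d * frag_of [Lz] - tau_z (frag_of v) * frag_of [L0]) - (0 - tau_zp (frag_of w))"
    unfolding wv tau_z_frag_of_Cons tau_zp_frag_of_Cons ltr_def[symmetric]
    by (simp add: algebra_simps)
  then show ?thesis
    using lambda_rel_diff[OF lambda_rel_diff[OF 1 2] lambda_rel_diff[OF lambda_rel_0 3]] by simp
qed

section \<open>The ideal generated by the duality relations\<close>

text \<open>The part of \<open>I_CF\<close> visible through \<open>lambda_rel\<close>; in this form
  it can be checked to be an ideal.\<close>

definition J_CF :: "ncpoly set" where
  "J_CF = {p \<in> A0. \<exists>x \<in> I_ST. lambda_rel x p}"

lemma J_CF_0: "0 \<in> J_CF"
  unfolding J_CF_def using lambda_rel_0 I_ST_0 by (auto simp: A0_def)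

lemma J_CF_diff: "p \<in> J_CF \<Longrightarrow> q \<in> J_CF \<Longrightarrow> p - q \<in> J_CF"
  unfolding J_CF_def
  using lambda_rel_diff I_ST_diff by (auto simp: A0_def word_span_diff) blast

lemma J_CF_shuffle: "p \<in> J_CF \<Longrightarrow> u \<in> A0 \<Longrightarrow> shuffle u p \<in> J_CF"
  unfolding J_CF_def
  using lambda_rel_shuffle_left I_ST_shuffle shuffle_A0 by blast

lemma Delta_in_J_CF:
  assumes "w \<in> A0" shows "Delta w \<in> J_CF"
  using assms unfolding A0_def
proof (induction w rule: word_span_induct)
  case zero
  show ?case using J_CF_0 by (simp add: Delta_def tau_inf_def)
next
  case (word w)
  \<comment> \<open>The witness: lambda sends the first term to \<open>frag_of w\<close> and fixes
    the second, which lies in \<open>A0\<close>.\<close>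
  have "lambda_rel (tau_z (frag_of w) - tau_inf (frag_of w)) (Delta (frag_of w))"
    unfolding Delta_def
    by (rule lambda_rel_diff[OF lambda_rel_tau_z lambda_rel_A0]) (use word tau_inf_A0_word in auto)
  moreover have "Delta (frag_of w) \<in> A0"
    using word tau_inf_A0_word[OF word] by (simp add: Delta_def A0_def word_span_diff)
  ultimately show ?case
    unfolding J_CF_def using tau_z_minus_tau_inf_I_ST[OF word] by blast
next
  case (diff p q)
  have "Delta (p - q) = Delta p - Delta q"
    by (simp add: Delta_def tau_inf_def antihom_ext_diff)
  then show ?case using J_CF_diff diff by simp
qed

lemma ring_A0_ring: "ring A0_ring"
proof (rule ringI)
  show "abelian_group A0_ring"
  proof (rule abelian_groupI)
    fix x assume "x \<in> carrier A0_ring"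
    then show "\<exists>y\<in>carrier A0_ring. y \<oplus>\<^bsub>A0_ring\<^esub> x = \<zero>\<^bsub>A0_ring\<^esub>"
      by (intro bexI[of _ "- x"]) (auto simp: A0_ring_def A0_def word_span_uminus)
  qed (auto simp: A0_ring_def A0_def word_span_add add_ac)
  have "1 \<in> A0"
    by (simp add: A0_def one_in_word_span words_0_def)
  then show "Group.monoid A0_ring"
    by (intro monoidI) (auto simp: A0_ring_def shuffle_A0 shuffle_assoc)
qed (auto simp: A0_ring_def shuffle_linear)

lemma ideal_J_CF: "ideal J_CF A0_ring"
proof (rule idealI[OF ring_A0_ring])
  have "group (add_monoid A0_ring)"
    using ring.is_abelian_group[OF ring_A0_ring] abelian_group.a_group by blast
  then show "subgroup J_CF (add_monoid A0_ring)"
  proof (rule group.subgroupI)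
    show "J_CF \<subseteq> carrier (add_monoid A0_ring)" by (auto simp: J_CF_def A0_ring_def)
    show "J_CF \<noteq> {}" using J_CF_0 by blast
    fix a b assume a: "a \<in> J_CF"
    have "inv\<^bsub>add_monoid A0_ring\<^esub> a = - a"
    proof (rule group.inv_equality[OF \<open>group _\<close>])
      show "- a \<otimes>\<^bsub>add_monoid A0_ring\<^esub> a = \<one>\<^bsub>add_monoid A0_ring\<^esub>"
        by (simp add: A0_ring_def)
    qed (use a in \<open>auto simp: A0_ring_def J_CF_def A0_def word_span_uminus\<close>)
    then show "inv\<^bsub>add_monoid A0_ring\<^esub> a \<in> J_CF"
      using J_CF_diff[OF J_CF_0 a] by simp
    assume "b \<in> J_CF"
    then show "a \<otimes>\<^bsub>add_monoid A0_ring\<^esub> b \<in> J_CF"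
      using minus_closed_imp_plus_closed[OF J_CF_diff J_CF_0 a] by (simp add: A0_ring_def)
  qed
qed (use J_CF_shuffle shuffle_commute in \<open>auto simp: A0_ring_def\<close>)

theorem theorem28:
  shows "I_Delta \<subseteq> I_CF"
proof -
  \<comment> \<open>\<open>genideal\<close> is the intersection of all ideals containing the
    generators, and \<open>J_CF\<close> is one of them.\<close>
  have "I_Delta \<subseteq> J_CF"
    unfolding I_Delta_def genideal_def using ideal_J_CF Delta_in_J_CF by blast
  also have "J_CF \<subseteq> I_CF"
    unfolding J_CF_def I_CF_def using lambda_map_eqI by blast
  finally show ?thesis .
qed

end
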